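(* Let $\{x_k\}$ be an infinite sequence generated by the SQP-type algorithm described in the context, under Assumption A, with associated multipliers $\{(\bar\mu_{k+1},\bar Y_{k+1})\}$ and feasibility residuals $R_k^{fea}:=R^{fea}(x_k,\bar\mu_{k+1},\bar Y_{k+1})$. Then $$\lim_{k\to\infty}R_k^{fea}=0.$$ Therefore, all limit points $(x,\mu,Y)$ of $\{(x_k,\bar\mu_{k+1},\bar Y_{k+1})\}$ are first-order optimal for the problem $\min_{x\in\mathbb R^n}v(x)$, i.e. they satisfy the first-order optimality system (S) given in the context.
   Context: Notation. $\mathcal S^m$ is the space of real symmetric $m\times m$ matrices, $\langle A,B\rangle=\mathrm{tr}(AB)$, $\preceq$ is the Loewner order, $\lambda_1(A)$ is the largest eigenvalue of $A$, $[a]_+=\max\{0,a\}$ and $[a]_-=\min\{0,a\}$ (componentwise for vectors), $\circ$ is the componentwise product, $e_l=(1,\dots,1)^T\in\mathbb R^l$, $I_m$ is the identity. Data: $f:\mathbb R^n\to\mathbb R$, $h:\mathbb R^n\to\mathbb R^l$, $G:\mathbb R^n\to\mathcal S^m$; $g=\nabla f$; $Dh(x)$ is the Jacobian of $h$; $DG(x)d=\sum_i d_i\,\partial G(x)/\partial x_i$; $DG(x)^*Y=(\langle\partial G(x)/\partial x_1,Y\rangle,\dots,\langle\partial G(x)/\partial x_n,Y\rangle)^T$. Subscript $k$ means evaluation at $x_k$ ($f_k,g_k,h_k,G_k,v_k$). Original problem (P): minimize $f(x)$ subject to $h(x)=0$, $G(x)\preceq0$. Constraint violation: $v(x)=\|h(x)\|_1+[\lambda_1(G(x))]_+$.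 Penalty function: $P^\rho(x)=\rho f(x)+v(x)$. Linearizations at $x_k$: $l_k^v(d)=\|h_k+Dh(x_k)d\|_1+[\lambda_1(G_k+DG(x_k)d)]_+$, $\Delta l_k^v(d)=l_k^v(0)-l_k^v(d)$, $\Delta l_k^\rho(d)=-\rho g_k^Td+\Delta l_k^v(d)$. Fritz-John function: $F(x,\rho,\mu,Y)=\rho f(x)+\mu^Th(x)+\langle Y,G(x)\rangle$. First-order optimality system (S) for $\min_x v(x)$ at $(x,\mu,Y)\in\mathbb R^n\times\mathbb R^l\times\mathcal S^m$: $Dh(x)^T\mu+DG(x)^*Y=0$; $(e_l-\mu)\circ[h(x)]_+=0$; $(e_l+\mu)\circ[h(x)]_-=0$; $(1-\mathrm{tr}(Y))[\lambda_1(G(x))]_+=0$; $\langle Y,G(x)-[\lambda_1(G(x))]_+I_m\rangle=0$; $-e_l\le\mu\le e_l$, $Y\succeq0$, $\mathrm{tr}(Y)\le1$. Feasibility residual: $R^{fea}(x,\mu,Y)=\|\nabla_xF(x,0,\mu,Y)\|_\infty+\|(e_l-\mu)\circ[h(x)]_+\|_\infty+\|(e_l+\mu)\circ[h(x)]_-\|_\infty+|1-\mathrm{tr}(Y)|[\lambda_1(G(x))]_++\|Y(G(x)-[\lambda_1(G(x))]_+I_m)\|_F$. Algorithm. Constants $\epsilon,\delta,\eta,\gamma\in(0,1)$, start $x_0\in\mathbb R^n$, $\rho_0>0$; positive definite matrices $B_k^{fea},B_k\in\mathcal S^n$ are given at each iteration. Iteration $k$: (1) Solve $\min_{d,r,s,t}\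 e_l^T(r+s)+t+\frac12d^TB_k^{fea}d$ s.t. $h_k+Dh(x_k)d=r-s$, $G_k+DG(x_k)d\preceq tI_m$, $r\ge0,s\ge0,t\ge0$ ($r,s\in\mathbb R^l$, $t\in\mathbb R$), giving $(d_k^{fea},r_k,s_k,t_k)$ and Lagrange multipliers $(\bar\mu_{k+1},\bar Y_{k+1})\in\mathbb R^l\times\mathcal S^m$ for the equality and semidefinite constraints (Lagrangian: objective $+\mu^T(h_k+Dh(x_k)d-r+s)+\langle Y,G_k+DG(x_k)d-tI_m\rangle-\nu_r^Tr-\nu_s^Ts-\nu_tt$, with $Y\succeq0$ and $\nu_r,\nu_s,\nu_t\ge0$). (2) Solve $\min_d\ \rho_kg_k^Td+\frac12d^TB_kd$ s.t. $h_k+Dh(x_k)d=r_k-s_k$, $G_k+DG(x_k)d\preceq t_kI_m$, giving $d_k$ and Lagrange multipliers $(\hat\mu_{k+1},\hat Y_{k+1})$ ($\hat Y_{k+1}\succeq0$), which are taken to exist. (3) If $d_k=0$, stop. (4) If $\rho_k(\|\bar\mu_{k+1}\|_\infty+\mathrm{tr}(\bar Y_{k+1}))>1$ or $\rho_k(\|\hat\mu_{k+1}\|_\infty+\mathrm{tr}(\hat Y_{k+1}))>1$, set $\rho_k'=\min\{\delta\rho_k,(1-\epsilon)/(\|\bar\mu_{k+1}\|_\infty+\mathrm{tr}(\bar Y_{k+1})+\|\hat\mu_{k+1}\|_\infty+\mathrm{tr}(\hat Y_{k+1}))\}$; otherwise $\rho_k'=\rho_k$. If $\Delta l_k^{\rho_k'}(d_k)<\epsilon\Delta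 l_k^v(d_k)$, set $\rho_{k+1}=\min\{\delta\rho_k',\zeta_k\}$ with $\zeta_k=(1-\epsilon)\Delta l_k^v(d_k)/(g_k^Td_k+\frac12d_k^TB_kd_k)$; otherwise $\rho_{k+1}=\rho_k'$. (5) Let $\alpha_k$ be the first $\alpha\in\{1,\gamma,\gamma^2,\dots\}$ with $P^{\rho_{k+1}}(x_k+\alpha d_k)-P^{\rho_{k+1}}(x_k)\le-\eta\alpha\Delta l_k^{\rho_{k+1}}(d_k)$; set $x_{k+1}=x_k+\alpha_kd_k$. (No cap on the number of iterations.) Assumption A. (A1) $f,h,G$ are twice continuously differentiable. (A2) There is a convex compact set $\Omega\subseteq\mathbb R^n$ with $x_k\in\Omega$ for all $k$. (A3) There are constants $0<b_1<b_2$ with $b_1\|d\|^2\le d^TB_k^{fea}d\le b_2\|d\|^2$ and $b_1\|d\|^2\le d^TB_kd\le b_2\|d\|^2$ for all $k$ and $d\in\mathbb R^n$. *)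

theory Defs
  imports "HOL-Analysis.Analysis"
begin

text \<open>
  Vectors and matrices are those of HOL-Analysis. On \<open>real ^ 'l\<close> the operations \<open>*\<close>, \<open>\<le>\<close> and the
  constant \<open>1\<close> are componentwise, so \<open>1\<close> is the all-ones vector and \<open>*\<close> the componentwise product.
  The library norm of \<open>real ^ 'm ^ 'm\<close> is the Frobenius norm.
\<close>

definition sym_matrix :: "real ^ 'm ^ 'm \<Rightarrow> bool" where
  "sym_matrix A \<longleftrightarrow> transpose A = A"

definition pos_semidef :: "real ^ 'm ^ 'm \<Rightarrow> bool" where
  "pos_semidef A \<longleftrightarrow> sym_matrix A \<and> (\<forall>x. 0 \<le> x \<bullet> (A *v x))"

definition pos_def :: "real ^ 'm ^ 'm \<Rightarrow> bool" where
  "pos_def A \<longleftrightarrow> sym_matrix A \<and> (\<forall>x. x \<noteq> 0 \<longrightarrow> 0 < x \<bullet> (A *v x))"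

definition loewner_le :: "real ^ 'm ^ 'm \<Rightarrow> real ^ 'm ^ 'm \<Rightarrow> bool" (infix "\<preceq>" 50) where
  "A \<preceq> B \<longleftrightarrow> pos_semidef (B - A)"

definition mat_inner :: "real ^ 'm ^ 'm \<Rightarrow> real ^ 'm ^ 'm \<Rightarrow> real" where
  "mat_inner A B = trace (A ** B)"

text \<open>Meant for symmetric \<open>A\<close>, whose set of real eigenvalues is finite and nonempty.\<close>

definition lambda_max :: "real ^ 'm ^ 'm \<Rightarrow> real" where
  "lambda_max A = Max {c. \<exists>v. v \<noteq> 0 \<and> A *v v = c *\<^sub>R v}"

definition pos_part :: "real ^ 'l \<Rightarrow> real ^ 'l" where
  "pos_part a = (\<chi> i. max 0 (a $ i))"

definition neg_part :: "real ^ 'l \<Rightarrow> real ^ 'l" where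
  "neg_part a = (\<chi> i. min 0 (a $ i))"

definition norm1 :: "real ^ 'l \<Rightarrow> real" where
  "norm1 a = (\<Sum>i\<in>UNIV. \<bar>a $ i\<bar>)"

definition partial_deriv :: "'n \<Rightarrow> (real ^ 'n \<Rightarrow> 'b::real_normed_vector) \<Rightarrow> real ^ 'n \<Rightarrow> 'b" where
  "partial_deriv i F x = frechet_derivative F (at x) (axis i 1)"

definition gradient :: "(real ^ 'n \<Rightarrow> real) \<Rightarrow> real ^ 'n \<Rightarrow> real ^ 'n" where
  "gradient F x = (\<chi> i. partial_deriv i F x)"

definition Jac :: "(real ^ 'n \<Rightarrow> real ^ 'l) \<Rightarrow> real ^ 'n \<Rightarrow> real ^ 'n ^ 'l" where
  "Jac h x = jacobian h (at x)"

definition DG :: "(real ^ 'n \<Rightarrow> real ^ 'm ^ 'm) \<Rightarrow> real ^ 'n \<Rightarrow> real ^ 'n \<Rightarrow> real ^ 'm ^ 'm" where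
  "DG G x d = (\<Sum>i\<in>UNIV. (d $ i) *\<^sub>R partial_deriv i G x)"

definition DG_adj :: "(real ^ 'n \<Rightarrow> real ^ 'm ^ 'm) \<Rightarrow> real ^ 'n \<Rightarrow> real ^ 'm ^ 'm \<Rightarrow> real ^ 'n" where
  "DG_adj G x Y = (\<chi> i. mat_inner (partial_deriv i G x) Y)"

definition twice_cont_diff :: "('a::real_normed_vector \<Rightarrow> 'b::real_normed_vector) \<Rightarrow> bool" where
  "twice_cont_diff F \<longleftrightarrow>
     (\<exists>(F' :: 'a \<Rightarrow> 'a \<Rightarrow>\<^sub>L 'b) (F'' :: 'a \<Rightarrow> 'a \<Rightarrow>\<^sub>L ('a \<Rightarrow>\<^sub>L 'b)).
        (\<forall>x. (F has_derivative blinfun_apply (F' x)) (at x)) \<and>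
        (\<forall>x. (F' has_derivative blinfun_apply (F'' x)) (at x)) \<and>
        continuous_on UNIV F'')"

definition violation :: "(real ^ 'n \<Rightarrow> real ^ 'l) \<Rightarrow> (real ^ 'n \<Rightarrow> real ^ 'm ^ 'm) \<Rightarrow> real ^ 'n \<Rightarrow> real" where
  "violation h G x = norm1 (h x) + max 0 (lambda_max (G x))"

definition penalty ::
  "(real ^ 'n \<Rightarrow> real) \<Rightarrow> (real ^ 'n \<Rightarrow> real ^ 'l) \<Rightarrow> (real ^ 'n \<Rightarrow> real ^ 'm ^ 'm) \<Rightarrow>
   real \<Rightarrow> real ^ 'n \<Rightarrow> real" where
  "penalty f h G \<rho> x = \<rho> * f x + violation h G x"

definition lin_violation ::
  "(real ^ 'n \<Rightarrow> real ^ 'l) \<Rightarrow> (real ^ 'n \<Rightarrow> real ^ 'm ^ 'm) \<Rightarrow> real ^ 'n \<Rightarrow> real ^ 'n \<Rightarrow> real" where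
  "lin_violation h G x d =
     norm1 (h x + Jac h x *v d) + max 0 (lambda_max (G x + DG G x d))"

definition delta_lin_violation ::
  "(real ^ 'n \<Rightarrow> real ^ 'l) \<Rightarrow> (real ^ 'n \<Rightarrow> real ^ 'm ^ 'm) \<Rightarrow> real ^ 'n \<Rightarrow> real ^ 'n \<Rightarrow> real" where
  "delta_lin_violation h G x d = lin_violation h G x 0 - lin_violation h G x d"

definition delta_lin_penalty ::
  "(real ^ 'n \<Rightarrow> real) \<Rightarrow> (real ^ 'n \<Rightarrow> real ^ 'l) \<Rightarrow> (real ^ 'n \<Rightarrow> real ^ 'm ^ 'm) \<Rightarrow>
   real \<Rightarrow> real ^ 'n \<Rightarrow> real ^ 'n \<Rightarrow> real" where
  "delta_lin_penalty f h G \<rho> x d = - \<rho> * (gradient f x \<bullet> d) + delta_lin_violation h G x d"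

definition fritz_john ::
  "(real ^ 'n \<Rightarrow> real) \<Rightarrow> (real ^ 'n \<Rightarrow> real ^ 'l) \<Rightarrow> (real ^ 'n \<Rightarrow> real ^ 'm ^ 'm) \<Rightarrow>
   real ^ 'n \<Rightarrow> real \<Rightarrow> real ^ 'l \<Rightarrow> real ^ 'm ^ 'm \<Rightarrow> real" where
  "fritz_john f h G x \<rho> \<mu> Y = \<rho> * f x + \<mu> \<bullet> h x + mat_inner Y (G x)"

definition violation_first_order ::
  "(real ^ 'n \<Rightarrow> real ^ 'l) \<Rightarrow> (real ^ 'n \<Rightarrow> real ^ 'm ^ 'm) \<Rightarrow>
   real ^ 'n \<Rightarrow> real ^ 'l \<Rightarrow> real ^ 'm ^ 'm \<Rightarrow> bool" where
  "violation_first_order h G x \<mu> Y \<longleftrightarrow>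
     transpose (Jac h x) *v \<mu> + DG_adj G x Y = 0 \<and>
     (1 - \<mu>) * pos_part (h x) = 0 \<and>
     (1 + \<mu>) * neg_part (h x) = 0 \<and>
     (1 - trace Y) * max 0 (lambda_max (G x)) = 0 \<and>
     mat_inner Y (G x - max 0 (lambda_max (G x)) *\<^sub>R mat 1) = 0 \<and>
     - 1 \<le> \<mu> \<and> \<mu> \<le> 1 \<and> pos_semidef Y \<and> trace Y \<le> 1"

definition feas_residual ::
  "(real ^ 'n \<Rightarrow> real) \<Rightarrow> (real ^ 'n \<Rightarrow> real ^ 'l) \<Rightarrow> (real ^ 'n \<Rightarrow> real ^ 'm ^ 'm) \<Rightarrow>
   real ^ 'n \<Rightarrow> real ^ 'l \<Rightarrow> real ^ 'm ^ 'm \<Rightarrow> real" where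
  "feas_residual f h G x \<mu> Y =
     infnorm (gradient (\<lambda>z. fritz_john f h G z 0 \<mu> Y) x) +
     infnorm ((1 - \<mu>) * pos_part (h x)) +
     infnorm ((1 + \<mu>) * neg_part (h x)) +
     \<bar>1 - trace Y\<bar> * max 0 (lambda_max (G x)) +
     norm (Y ** (G x - max 0 (lambda_max (G x)) *\<^sub>R mat 1))"

definition feas_objective ::
  "real ^ 'n ^ 'n \<Rightarrow> (real ^ 'n) \<times> (real ^ 'l) \<times> (real ^ 'l) \<times> real \<Rightarrow> real" where
  "feas_objective B = (\<lambda>(d, r, s, t). 1 \<bullet> (r + s) + t + 1/2 * (d \<bullet> (B *v d)))"

definition feas_constraints ::
  "(real ^ 'n \<Rightarrow> real ^ 'l) \<Rightarrow> (real ^ 'n \<Rightarrow> real ^ 'm ^ 'm) \<Rightarrow> real ^ 'n \<Rightarrow>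
   (real ^ 'n) \<times> (real ^ 'l) \<times> (real ^ 'l) \<times> real \<Rightarrow> bool" where
  "feas_constraints h G x = (\<lambda>(d, r, s, t).
     h x + Jac h x *v d = r - s \<and>
     G x + DG G x d \<preceq> t *\<^sub>R mat 1 \<and>
     0 \<le> r \<and> 0 \<le> s \<and> 0 \<le> t)"

definition feas_lagrangian ::
  "(real ^ 'n \<Rightarrow> real ^ 'l) \<Rightarrow> (real ^ 'n \<Rightarrow> real ^ 'm ^ 'm) \<Rightarrow> real ^ 'n ^ 'n \<Rightarrow> real ^ 'n \<Rightarrow>
   real ^ 'l \<Rightarrow> real ^ 'm ^ 'm \<Rightarrow> real ^ 'l \<Rightarrow> real ^ 'l \<Rightarrow> real \<Rightarrow>
   (real ^ 'n) \<times> (real ^ 'l) \<times> (real ^ 'l) \<times> real \<Rightarrow> real" where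
  "feas_lagrangian h G B x \<mu> Y \<nu>r \<nu>s \<nu>t = (\<lambda>(d, r, s, t).
     feas_objective B (d, r, s, t) +
     \<mu> \<bullet> (h x + Jac h x *v d - r + s) +
     mat_inner Y (G x + DG G x d - t *\<^sub>R mat 1) -
     \<nu>r \<bullet> r - \<nu>s \<bullet> s - \<nu>t * t)"

text \<open>
  Lagrange multipliers are understood in the Karush-Kuhn-Tucker sense: dual feasibility,
  stationarity of the Lagrangian in all primal variables, and complementary slackness.
\<close>

definition feas_multipliers ::
  "(real ^ 'n \<Rightarrow> real ^ 'l) \<Rightarrow> (real ^ 'n \<Rightarrow> real ^ 'm ^ 'm) \<Rightarrow> real ^ 'n ^ 'n \<Rightarrow> real ^ 'n \<Rightarrow>
   real ^ 'n \<Rightarrow> real ^ 'l \<Rightarrow> real ^ 'l \<Rightarrow> real \<Rightarrow> real ^ 'l \<Rightarrow> real ^ 'm ^ 'm \<Rightarrow> bool" where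
  "feas_multipliers h G B x d r s t \<mu> Y \<longleftrightarrow>
     pos_semidef Y \<and>
     mat_inner Y (G x + DG G x d - t *\<^sub>R mat 1) = 0 \<and>
     (\<exists>\<nu>r \<nu>s \<nu>t. 0 \<le> \<nu>r \<and> 0 \<le> \<nu>s \<and> 0 \<le> \<nu>t \<and>
        \<nu>r \<bullet> r = 0 \<and> \<nu>s \<bullet> s = 0 \<and> \<nu>t * t = 0 \<and>
        GDERIV (feas_lagrangian h G B x \<mu> Y \<nu>r \<nu>s \<nu>t) (d, r, s, t) :> 0)"

definition feas_step ::
  "(real ^ 'n \<Rightarrow> real ^ 'l) \<Rightarrow> (real ^ 'n \<Rightarrow> real ^ 'm ^ 'm) \<Rightarrow> real ^ 'n ^ 'n \<Rightarrow> real ^ 'n \<Rightarrow>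
   real ^ 'n \<Rightarrow> real ^ 'l \<Rightarrow> real ^ 'l \<Rightarrow> real \<Rightarrow> real ^ 'l \<Rightarrow> real ^ 'm ^ 'm \<Rightarrow> bool" where
  "feas_step h G B x d r s t \<mu> Y \<longleftrightarrow>
     is_arg_min (feas_objective B) (feas_constraints h G x) (d, r, s, t) \<and>
     feas_multipliers h G B x d r s t \<mu> Y"

definition opt_objective ::
  "(real ^ 'n \<Rightarrow> real) \<Rightarrow> real ^ 'n ^ 'n \<Rightarrow> real \<Rightarrow> real ^ 'n \<Rightarrow> real ^ 'n \<Rightarrow> real" where
  "opt_objective f B \<rho> x d = \<rho> * (gradient f x \<bullet> d) + 1/2 * (d \<bullet> (B *v d))"

definition opt_constraints ::
  "(real ^ 'n \<Rightarrow> real ^ 'l) \<Rightarrow> (real ^ 'n \<Rightarrow> real ^ 'm ^ 'm) \<Rightarrow> real ^ 'n \<Rightarrow>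
   real ^ 'l \<Rightarrow> real ^ 'l \<Rightarrow> real \<Rightarrow> real ^ 'n \<Rightarrow> bool" where
  "opt_constraints h G x r s t d \<longleftrightarrow>
     h x + Jac h x *v d = r - s \<and> G x + DG G x d \<preceq> t *\<^sub>R mat 1"

definition opt_lagrangian ::
  "(real ^ 'n \<Rightarrow> real) \<Rightarrow> (real ^ 'n \<Rightarrow> real ^ 'l) \<Rightarrow> (real ^ 'n \<Rightarrow> real ^ 'm ^ 'm) \<Rightarrow>
   real ^ 'n ^ 'n \<Rightarrow> real \<Rightarrow> real ^ 'n \<Rightarrow> real ^ 'l \<Rightarrow> real ^ 'l \<Rightarrow> real \<Rightarrow>
   real ^ 'l \<Rightarrow> real ^ 'm ^ 'm \<Rightarrow> real ^ 'n \<Rightarrow> real" where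
  "opt_lagrangian f h G B \<rho> x r s t \<mu> Y d =
     opt_objective f B \<rho> x d +
     \<mu> \<bullet> (h x + Jac h x *v d - r + s) +
     mat_inner Y (G x + DG G x d - t *\<^sub>R mat 1)"

definition opt_multipliers ::
  "(real ^ 'n \<Rightarrow> real) \<Rightarrow> (real ^ 'n \<Rightarrow> real ^ 'l) \<Rightarrow> (real ^ 'n \<Rightarrow> real ^ 'm ^ 'm) \<Rightarrow>
   real ^ 'n ^ 'n \<Rightarrow> real \<Rightarrow> real ^ 'n \<Rightarrow> real ^ 'l \<Rightarrow> real ^ 'l \<Rightarrow> real \<Rightarrow>
   real ^ 'n \<Rightarrow> real ^ 'l \<Rightarrow> real ^ 'm ^ 'm \<Rightarrow> bool" where
  "opt_multipliers f h G B \<rho> x r s t d \<mu> Y \<longleftrightarrow>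
     pos_semidef Y \<and>
     mat_inner Y (G x + DG G x d - t *\<^sub>R mat 1) = 0 \<and>
     GDERIV (opt_lagrangian f h G B \<rho> x r s t \<mu> Y) d :> 0"

definition opt_step ::
  "(real ^ 'n \<Rightarrow> real) \<Rightarrow> (real ^ 'n \<Rightarrow> real ^ 'l) \<Rightarrow> (real ^ 'n \<Rightarrow> real ^ 'm ^ 'm) \<Rightarrow>
   real ^ 'n ^ 'n \<Rightarrow> real \<Rightarrow> real ^ 'n \<Rightarrow> real ^ 'l \<Rightarrow> real ^ 'l \<Rightarrow> real \<Rightarrow>
   real ^ 'n \<Rightarrow> real ^ 'l \<Rightarrow> real ^ 'm ^ 'm \<Rightarrow> bool" where
  "opt_step f h G B \<rho> x r s t d \<mu> Y \<longleftrightarrow>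
     is_arg_min (opt_objective f B \<rho> x) (opt_constraints h G x r s t) d \<and>
     opt_multipliers f h G B \<rho> x r s t d \<mu> Y"

definition penalty_multiplier_update ::
  "real \<Rightarrow> real \<Rightarrow> real \<Rightarrow> real ^ 'l \<Rightarrow> real ^ 'm ^ 'm \<Rightarrow> real ^ 'l \<Rightarrow> real ^ 'm ^ 'm \<Rightarrow> real" where
  "penalty_multiplier_update \<epsilon> \<delta> \<rho> \<mu>bar Ybar \<mu>hat Yhat =
     (if \<rho> * (infnorm \<mu>bar + trace Ybar) > 1 \<or> \<rho> * (infnorm \<mu>hat + trace Yhat) > 1
      then min (\<delta> * \<rho>)
             ((1 - \<epsilon>) / (infnorm \<mu>bar + trace Ybar + infnorm \<mu>hat + trace Yhat))
      else \<rho>)"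

definition penalty_decrease_update ::
  "(real ^ 'n \<Rightarrow> real) \<Rightarrow> (real ^ 'n \<Rightarrow> real ^ 'l) \<Rightarrow> (real ^ 'n \<Rightarrow> real ^ 'm ^ 'm) \<Rightarrow>
   real \<Rightarrow> real \<Rightarrow> real ^ 'n ^ 'n \<Rightarrow> real ^ 'n \<Rightarrow> real ^ 'n \<Rightarrow> real \<Rightarrow> real" where
  "penalty_decrease_update f h G \<epsilon> \<delta> B x d \<rho>' =
     (if delta_lin_penalty f h G \<rho>' x d < \<epsilon> * delta_lin_violation h G x d
      then min (\<delta> * \<rho>')
             ((1 - \<epsilon>) * delta_lin_violation h G x d / (gradient f x \<bullet> d + 1/2 * (d \<bullet> (B *v d))))
      else \<rho>')"

definition sufficient_decrease ::
  "(real ^ 'n \<Rightarrow> real) \<Rightarrow> (real ^ 'n \<Rightarrow> real ^ 'l) \<Rightarrow> (real ^ 'n \<Rightarrow> real ^ 'm ^ 'm) \<Rightarrow>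
   real \<Rightarrow> real \<Rightarrow> real ^ 'n \<Rightarrow> real ^ 'n \<Rightarrow> real \<Rightarrow> bool" where
  "sufficient_decrease f h G \<eta> \<rho> x d \<alpha> \<longleftrightarrow>
     penalty f h G \<rho> (x + \<alpha> *\<^sub>R d) - penalty f h G \<rho> x \<le> - \<eta> * \<alpha> * delta_lin_penalty f h G \<rho> x d"

definition line_search ::
  "(real ^ 'n \<Rightarrow> real) \<Rightarrow> (real ^ 'n \<Rightarrow> real ^ 'l) \<Rightarrow> (real ^ 'n \<Rightarrow> real ^ 'm ^ 'm) \<Rightarrow>
   real \<Rightarrow> real \<Rightarrow> real \<Rightarrow> real ^ 'n \<Rightarrow> real ^ 'n \<Rightarrow> real \<Rightarrow> bool" where
  "line_search f h G \<eta> \<gamma> \<rho> x d \<alpha> \<longleftrightarrow>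
     (\<exists>j::nat. \<alpha> = \<gamma> ^ j \<and> sufficient_decrease f h G \<eta> \<rho> x d (\<gamma> ^ j) \<and>
        (\<forall>i<j. \<not> sufficient_decrease f h G \<eta> \<rho> x d (\<gamma> ^ i)))"

end

theory Submission
  imports Defs
begin

text \<open>
  Everything rests on the step \<open>dfea k\<close> of the feasibility subproblem. It controls the residual:
  stationarity of the Lagrangian says that the Fritz-John gradient with \<open>\<rho> = 0\<close> is
  \<open>- Bfea k *v dfea k\<close>, and the complementarity conditions hold exactly for the linearized constraints
  at \<open>dfea k\<close>, hence up to an error of order \<open>norm (dfea k)\<close> at \<open>x k\<close> (\<open>feas_residual_le_step\<close>). For the
  product of \<open>Y\<close> with the shifted constraint matrix this uses that two positive semidefinite matrices
  with vanishing inner product have product zero (\<open>pos_semidef_mult_eq_zero\<close>). So it suffices that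
  \<open>dfea k\<close> tends to zero.

  The second subproblem keeps the linearized violation reached by the first one, so the step \<open>d k\<close>
  decreases the linearized violation by at least \<open>b1 / 2 * (norm (dfea k))\<^sup>2\<close>
  (\<open>violation_decrease_ge\<close>). The penalty update keeps \<open>\<rho>\<close> positive and nonincreasing and makes the
  decrease of the penalty model at least \<open>\<epsilon>\<close> times the decrease of the linearized violation
  (\<open>penalty_parameter_step\<close>). The steps \<open>d k\<close> are bounded because \<open>dfea k\<close> is feasible for the second
  subproblem, so second-order remainders bound the step length from below by
  \<open>min 1 (c * \<Delta> k)\<close>, where \<open>\<Delta> k\<close> is the model decrease (\<open>step_length_ge\<close>).

  Finally, with a lower bound \<open>- M\<close> of \<open>f\<close> on the compact set, the merit function
  \<open>\<rho> k * (f (x k) + M) + violation h G (x k)\<close> is nonnegative and drops by at least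
  \<open>\<eta> * \<alpha> k * \<Delta> k\<close> in each iteration; the shift by \<open>M\<close> makes a decrease of \<open>\<rho>\<close> harmless. Hence \<open>min 1 (c * \<Delta> k) * \<Delta> k\<close> tends to zero, and with it \<open>\<Delta> k\<close>
  and \<open>dfea k\<close>. Limit points inherit the first-order system because the residual is continuous and the
  bounds on the multipliers are closed conditions.\<close>

section \<open>Positive semidefinite matrices and the largest eigenvalue\<close>

lemma sym_matrix_inner:
  assumes "sym_matrix A"
  shows "x \<bullet> (A *v y) = (A *v x) \<bullet> y"
  using assms unfolding sym_matrix_def
  by (metis dot_lmul_matrix vector_transpose_matrix)

lemma norm_matrix_vector_mult_le:
  fixes A :: "real ^ 'n ^ 'm"
  shows "norm (A *v x) \<le> norm A * norm x"
proof -
  have "norm (A *v x) = L2_set (\<lambda>i. \<bar>(A $ i) \<bullet> x\<bar>) UNIV"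
    by (simp add: norm_vec_def matrix_vector_mul_component)
  also have "\<dots> \<le> L2_set (\<lambda>i. norm (A $ i) * norm x) UNIV"
    by (intro L2_set_mono) (auto simp: Cauchy_Schwarz_ineq2)
  also have "\<dots> = norm A * norm x"
    by (simp add: norm_vec_def[of A] L2_set_left_distrib)
  finally show ?thesis .
qed

lemma quadratic_form_le_norm:
  fixes A :: "real ^ 'n ^ 'n"
  shows "x \<bullet> (A *v x) \<le> norm A * (x \<bullet> x)"
proof -
  have "x \<bullet> (A *v x) \<le> norm x * norm (A *v x)"
    by (rule norm_cauchy_schwarz)
  also have "\<dots> \<le> norm x * (norm A * norm x)"
    by (intro mult_left_mono norm_matrix_vector_mult_le) auto
  finally show ?thesis
    by (simp add: dot_square_norm power2_eq_square mult_ac)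
qed

lemma norm_matrix_mult_le:
  fixes A :: "real ^ 'n ^ 'm" and B :: "real ^ 'p ^ 'n"
  shows "norm (A ** B) \<le> norm A * norm B"
proof -
  have row: "(A ** B) $ i = transpose B *v (A $ i)" for i
    by (simp add: vec_eq_iff matrix_matrix_mult_def matrix_vector_mult_def transpose_def mult.commute)
  have tr: "norm (transpose B) = norm B"
  proof -
    have "(norm (transpose B))\<^sup>2 = (norm B)\<^sup>2"
      unfolding power2_norm_eq_inner inner_vec_def transpose_def
      by (simp, rule sum.swap)
    then show ?thesis by simp
  qed
  have "norm (A ** B) = L2_set (\<lambda>i. norm ((A ** B) $ i)) UNIV" by (rule norm_vec_def)
  also have "\<dots> \<le> L2_set (\<lambda>i. norm B * norm (A $ i)) UNIV"
    using norm_matrix_vector_mult_le[of "transpose B"] by (intro L2_set_mono) (simp_all only: row tr norm_ge_zero)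
  also have "\<dots> = norm A * norm B"
    by (simp add: norm_vec_def[of A] L2_set_right_distrib mult.commute[of _ "norm B"])
  finally show ?thesis .
qed

lemma bounded_bilinear_matrix_mult:
  "bounded_bilinear ((**) :: real ^ 'n ^ 'm \<Rightarrow> real ^ 'p ^ 'n \<Rightarrow> real ^ 'p ^ 'm)"
proof
  fix A A' :: "real ^ 'n ^ 'm" and B B' :: "real ^ 'p ^ 'n" and c :: real
  show "(A + A') ** B = A ** B + A' ** B" "A ** (B + B') = A ** B + A ** B'"
    by (simp_all add: vec_eq_iff matrix_matrix_mult_def sum.distrib algebra_simps)
  show "(c *\<^sub>R A) ** B = c *\<^sub>R (A ** B)" "A ** (c *\<^sub>R B) = c *\<^sub>R (A ** B)"
    by (simp_all add: vec_eq_iff matrix_matrix_mult_def sum_distrib_left mult_ac)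
  show "\<exists>K. \<forall>(A :: real ^ 'n ^ 'm) (B :: real ^ 'p ^ 'n). norm (A ** B) \<le> norm A * norm B * K"
    by (intro exI[of _ 1] allI) (simp add: norm_matrix_mult_le)
qed

text \<open>The quadratic form of \<open>A\<close> is nonnegative on the plane spanned by \<open>x\<close> and \<open>y\<close>; evaluate it at suitable
  combinations, as for an inner product. The form may be degenerate, so the case \<open>x \<bullet> (A *v x) = 0\<close> is separate.\<close>

lemma pos_semidef_cauchy_schwarz:
  assumes "pos_semidef A"
  shows "(x \<bullet> (A *v y))\<^sup>2 \<le> (x \<bullet> (A *v x)) * (y \<bullet> (A *v y))"
proof -
  define a b c where "a = x \<bullet> (A *v x)" "b = x \<bullet> (A *v y)" "c = y \<bullet> (A *v y)"
  have sym: "sym_matrix A" and nn: "\<And>z. 0 \<le> z \<bullet> (A *v z)"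
    using assms by (auto simp: pos_semidef_def)
  have expand: "(u *\<^sub>R x + v *\<^sub>R y) \<bullet> (A *v (u *\<^sub>R x + v *\<^sub>R y)) = u\<^sup>2 * a + 2 * u * v * b + v\<^sup>2 * c" for u v
  proof -
    have "y \<bullet> (A *v x) = b"
      using sym_matrix_inner[OF sym] by (simp add: a_b_c_def inner_commute)
    then show ?thesis
      by (simp add: a_b_c_def matrix_vector_right_distrib matrix_vector_mult_scaleR
          inner_add_left inner_add_right power2_eq_square algebra_simps)
  qed
  have q: "0 \<le> u\<^sup>2 * a + 2 * u * v * b + v\<^sup>2 * c" for u v
    using nn[of "u *\<^sub>R x + v *\<^sub>R y"] expand by simp
  have "a \<ge> 0" using nn by (simp add: a_b_c_def)
  show ?thesis
  proof (cases "a = 0")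
    case True
    have "b = 0"
    proof (rule ccontr)
      assume "b \<noteq> 0"
      then have "2 * (- (c + 1) / (2 * b)) * 1 * b = - (c + 1)" by (simp add: field_simps)
      then show False
        \<comment> \<open>for \<open>a = 0\<close> the form is affine in \<open>u\<close>; this \<open>u\<close> gives it the value \<open>- 1\<close>\<close>
        using q[of "- (c + 1) / (2 * b)" 1] True by simp
    qed
    then show ?thesis using True by (simp add: a_b_c_def)
  next
    case False
    have "0 \<le> a * (a * c - b\<^sup>2)"
      using q[of "- b" a] by (simp add: power2_eq_square algebra_simps)
    then have "b\<^sup>2 \<le> a * c"
      using False \<open>a \<ge> 0\<close> by (simp add: zero_le_mult_iff)
    then show ?thesis by (simp add: a_b_c_def)
  qed
qed

text \<open>Cauchy-Schwarz for the pair \<open>A *v x\<close> and \<open>x\<close>.\<close>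

lemma pos_semidef_kernel:
  assumes "pos_semidef A" "x \<bullet> (A *v x) = 0"
  shows "A *v x = 0"
proof -
  have "((A *v x) \<bullet> (A *v x))\<^sup>2 \<le> ((A *v x) \<bullet> (A *v (A *v x))) * (x \<bullet> (A *v x))"
    by (rule pos_semidef_cauchy_schwarz[OF assms(1)])
  then show ?thesis using assms(2) by simp
qed

lemma pos_semidef_norm_le:
  assumes "pos_semidef A" and ub: "\<And>z. z \<bullet> (A *v z) \<le> b * (norm z)\<^sup>2" and "0 \<le> b"
  shows "norm (A *v x) \<le> b * norm x"
proof -
  define w where "w = A *v x"
  have "(w \<bullet> (A *v x))\<^sup>2 \<le> (w \<bullet> (A *v w)) * (x \<bullet> (A *v x))"
    by (rule pos_semidef_cauchy_schwarz[OF assms(1)])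
  also have "\<dots> \<le> (b * (norm w)\<^sup>2) * (b * (norm x)\<^sup>2)"
    using assms by (intro mult_mono ub) (auto simp: pos_semidef_def)
  finally have "(norm w)\<^sup>2 * (norm w)\<^sup>2 \<le> (norm w)\<^sup>2 * (b * norm x)\<^sup>2"
    by (simp add: w_def[symmetric] dot_square_norm power2_eq_square mult_ac)
  then have "w = 0 \<or> (norm w)\<^sup>2 \<le> (b * norm x)\<^sup>2"
    by (metis mult_le_cancel_left_pos norm_eq_zero zero_less_power2)
  then show ?thesis
    using \<open>0 \<le> b\<close> by (auto simp: w_def[symmetric] intro: power2_le_imp_le)
qed

text \<open>Needed for \<open>Max\<close> in the definition of the largest eigenvalue to be meaningful: eigenvectors for different
  eigenvalues are orthogonal, hence independent.\<close>

lemma finite_eigenvalues: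
  assumes "sym_matrix A"
  shows "finite {c. \<exists>v. v \<noteq> 0 \<and> A *v v = c *\<^sub>R v}" (is "finite ?E")
proof -
  have "\<forall>c\<in>?E. \<exists>v. v \<noteq> 0 \<and> A *v v = c *\<^sub>R v" by blast
  then obtain v where "\<forall>c\<in>?E. v c \<noteq> 0 \<and> A *v v c = c *\<^sub>R v c"
    by (rule bchoice[THEN exE])
  then have v: "c \<in> ?E \<Longrightarrow> v c \<noteq> 0 \<and> A *v v c = c *\<^sub>R v c" for c
    by (rule bspec)
  have orth: "v a \<bullet> v b = 0" if "a \<in> ?E" "b \<in> ?E" "a \<noteq> b" for a b
  proof -
    have "b * (v a \<bullet> v b) = a * (v a \<bullet> v b)"
      using sym_matrix_inner[OF assms, of "v a" "v b"] v[OF that(1)] v[OF that(2)] by simp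
    then show ?thesis using that(3) by simp
  qed
  have inj: "inj_on v ?E"
  proof (rule inj_onI)
    fix a b assume ab: "a \<in> ?E" "b \<in> ?E" "v a = v b"
    then show "a = b" using orth[OF ab(1,2)] v[OF ab(1)] by (metis inner_eq_zero_iff)
  qed
  have "pairwise orthogonal (v ` ?E)"
    using orth by (auto simp: pairwise_def orthogonal_def) 
  moreover have "0 \<notin> v ` ?E" using v by force
  ultimately have "independent (v ` ?E)" by (rule pairwise_orthogonal_independent)
  then have "finite (v ` ?E)" using independent_imp_finite by blast
  then show ?thesis using inj by (rule finite_imageD)
qed

text \<open>If \<open>v\<close> maximizes the quadratic form on the unit sphere with value \<open>c\<close>, then \<open>c *\<^sub>R mat 1 - A\<close> is positive
  semidefinite and its form vanishes at \<open>v\<close>, so \<open>v\<close> lies in its kernel.\<close>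

lemma maximal_rayleigh_quotient_eigenvalue:
  assumes "sym_matrix A"
  obtains c v where "v \<noteq> 0" "A *v v = c *\<^sub>R v" "\<And>x. x \<bullet> (A *v x) \<le> c * (x \<bullet> x)"
proof -
  have cont: "continuous_on (sphere 0 1) (\<lambda>x. x \<bullet> (A *v x))"
    by (intro continuous_intros matrix_vector_mult_linear_continuous_on)
  have "axis undefined 1 \<in> sphere (0 :: real ^ 'a) 1"
    by simp
  then have "sphere (0 :: real ^ 'a) 1 \<noteq> {}" by blast
  then obtain v where v: "v \<in> sphere 0 1"
      and max: "\<And>y. y \<in> sphere 0 1 \<Longrightarrow> y \<bullet> (A *v y) \<le> v \<bullet> (A *v v)"
    using continuous_attains_sup[OF compact_sphere _ cont] by blast
  define c where "c = v \<bullet> (A *v v)"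
  have nv: "norm v = 1" using v by simp
  have ray: "x \<bullet> (A *v x) \<le> c * (x \<bullet> x)" for x
  proof (cases "x = 0")
    case False
    define y where "y = x /\<^sub>R norm x"
    have x: "x = norm x *\<^sub>R y" using False by (simp add: y_def)
    have "y \<bullet> (A *v y) \<le> c" using max[of y] False by (simp add: y_def c_def)
    then have "(norm x)\<^sup>2 * (y \<bullet> (A *v y)) \<le> (norm x)\<^sup>2 * c" by (intro mult_left_mono) auto
    moreover have "x \<bullet> (A *v x) = (norm x)\<^sup>2 * (y \<bullet> (A *v y))"
      by (subst (1 2) x) (simp add: matrix_vector_mult_scaleR power2_eq_square)
    ultimately show ?thesis by (simp add: dot_square_norm mult.commute)
  qed simp
  have shift: "(c *\<^sub>R mat 1 - A) *v x = c *\<^sub>R x - A *v x" for x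
    by (simp add: matrix_vector_mult_diff_rdistrib flip: scaleR_matrix_vector_assoc)
  have "sym_matrix (c *\<^sub>R mat 1 - A)"
    using assms by (simp add: sym_matrix_def vec_eq_iff transpose_def mat_def)
  then have psd: "pos_semidef (c *\<^sub>R mat 1 - A)"
    using ray by (simp add: pos_semidef_def shift inner_diff_right)
  have "v \<bullet> (c *\<^sub>R v - A *v v) = 0"
    using nv by (simp add: inner_diff_right dot_square_norm flip: c_def)
  then have "(c *\<^sub>R mat 1 - A) *v v = 0"
    by (intro pos_semidef_kernel[OF psd]) (simp only: shift)
  then have "A *v v = c *\<^sub>R v" by (simp add: shift)
  moreover have "v \<noteq> 0" using nv by auto
  ultimately show ?thesis by (rule that[OF _ _ ray, rotated])
qed

text \<open>All later estimates of the largest eigenvalue reduce to quadratic forms through this characterization.\<close>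

lemma lambda_max_le_iff:
  assumes "sym_matrix A"
  shows "lambda_max A \<le> c \<longleftrightarrow> (\<forall>x. x \<bullet> (A *v x) \<le> c * (x \<bullet> x))"
proof -
  obtain c0 v where v: "v \<noteq> 0" "A *v v = c0 *\<^sub>R v" and ray: "\<And>x. x \<bullet> (A *v x) \<le> c0 * (x \<bullet> x)"
    by (rule maximal_rayleigh_quotient_eigenvalue[OF assms], rule that)
  have le: "a \<le> b" if "w \<noteq> 0" "A *v w = a *\<^sub>R w" "\<And>x. x \<bullet> (A *v x) \<le> b * (x \<bullet> x)" for a b w
    using that(3)[of w] that(1,2) by simp
  have "lambda_max A = c0"
    unfolding lambda_max_def
  proof (rule Max_eqI[OF finite_eigenvalues[OF assms]])
    show "a \<le> c0" if "a \<in> {c. \<exists>v. v \<noteq> 0 \<and> A *v v = c *\<^sub>R v}" for a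
      using that le[OF _ _ ray] by auto
    show "c0 \<in> {c. \<exists>v. v \<noteq> 0 \<and> A *v v = c *\<^sub>R v}"
      using v by auto
  qed
  moreover have "x \<bullet> (A *v x) \<le> c * (x \<bullet> x)" if "c0 \<le> c" for x
    by (rule order_trans[OF ray mult_right_mono[OF that]]) simp
  moreover have "c0 \<le> c" if "\<forall>x. x \<bullet> (A *v x) \<le> c * (x \<bullet> x)"
    by (rule le[OF v]) (use that in simp)
  ultimately show ?thesis by (intro iffI allI) simp_all
qed

lemma quadratic_form_le_lambda_max:
  assumes "sym_matrix A"
  shows "x \<bullet> (A *v x) \<le> lambda_max A * (x \<bullet> x)"
  using iffD1[OF lambda_max_le_iff[OF assms] order_refl] by (rule spec)

lemma sym_matrix_add: "sym_matrix A \<Longrightarrow> sym_matrix B \<Longrightarrow> sym_matrix (A + B)"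
  and sym_matrix_diff: "sym_matrix A \<Longrightarrow> sym_matrix B \<Longrightarrow> sym_matrix (A - B)"
  and sym_matrix_scaleR: "sym_matrix A \<Longrightarrow> sym_matrix (c *\<^sub>R A)"
  and sym_matrix_scaled_identity: "sym_matrix (c *\<^sub>R mat 1)"
  by (simp_all add: sym_matrix_def vec_eq_iff transpose_def mat_def)

lemma loewner_le_scaled_identity_iff:
  "A \<preceq> c *\<^sub>R mat 1 \<longleftrightarrow> sym_matrix A \<and> lambda_max A \<le> c"
proof -
  have sym: "sym_matrix (c *\<^sub>R mat 1 - A) \<longleftrightarrow> sym_matrix A"
    using sym_matrix_diff[OF sym_matrix_scaled_identity, of A c]
      sym_matrix_diff[OF sym_matrix_scaled_identity, of "c *\<^sub>R mat 1 - A" c] by auto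
  have shift: "x \<bullet> ((c *\<^sub>R mat 1 - A) *v x) = c * (x \<bullet> x) - x \<bullet> (A *v x)" for x
    by (simp add: matrix_vector_mult_diff_rdistrib inner_diff_right flip: scaleR_matrix_vector_assoc)
  show ?thesis
    unfolding loewner_le_def pos_semidef_def sym shift
    using lambda_max_le_iff[of A c] by auto
qed

lemma lambda_max_convex_combination:
  assumes "sym_matrix A" "sym_matrix B" "0 \<le> u" "u \<le> 1"
  shows "lambda_max ((1 - u) *\<^sub>R A + u *\<^sub>R B) \<le> (1 - u) * lambda_max A + u * lambda_max B"
proof -
  have "sym_matrix ((1 - u) *\<^sub>R A + u *\<^sub>R B)"
    using assms by (simp add: sym_matrix_add sym_matrix_scaleR)
  moreover have "x \<bullet> (((1 - u) *\<^sub>R A + u *\<^sub>R B) *v x)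
      \<le> ((1 - u) * lambda_max A + u * lambda_max B) * (x \<bullet> x)" for x
  proof -
    have "x \<bullet> (((1 - u) *\<^sub>R A + u *\<^sub>R B) *v x) = (1 - u) * (x \<bullet> (A *v x)) + u * (x \<bullet> (B *v x))"
      by (simp add: matrix_vector_mult_add_rdistrib inner_add_right flip: scaleR_matrix_vector_assoc)
    also have "\<dots> \<le> (1 - u) * (lambda_max A * (x \<bullet> x)) + u * (lambda_max B * (x \<bullet> x))"
      using assms by (intro add_mono mult_left_mono quadratic_form_le_lambda_max) auto
    finally show ?thesis by (simp add: algebra_simps)
  qed
  ultimately show ?thesis by (simp add: lambda_max_le_iff)
qed

lemma lambda_max_le_add_norm:
  assumes "sym_matrix A" "sym_matrix B"
  shows "lambda_max A \<le> lambda_max B + norm (A - B)"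
proof -
  have "x \<bullet> (A *v x) \<le> (lambda_max B + norm (A - B)) * (x \<bullet> x)" for x
  proof -
    have "x \<bullet> (A *v x) = x \<bullet> (B *v x) + x \<bullet> ((A - B) *v x)"
      by (simp add: matrix_vector_mult_diff_rdistrib inner_diff_right)
    then show ?thesis
      using quadratic_form_le_lambda_max[OF assms(2), of x] quadratic_form_le_norm[of x "A - B"]
      by (simp add: algebra_simps)
  qed
  then show ?thesis using assms(1) by (simp add: lambda_max_le_iff)
qed

lemma lambda_max_lipschitz:
  assumes "sym_matrix A" "sym_matrix B"
  shows "\<bar>lambda_max A - lambda_max B\<bar> \<le> norm (A - B)"
  using lambda_max_le_add_norm[OF assms] lambda_max_le_add_norm[OF assms(2,1)]
  by (simp add: norm_minus_commute abs_le_iff)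

text \<open>Symmetric Gaussian elimination: subtracting the rank-one matrix of the scaled row \<open>i\<close> keeps the matrix
  positive semidefinite by Cauchy-Schwarz and clears row \<open>i\<close>. If the pivot \<open>Y $ i $ i\<close> is zero, the whole row is
  already zero.\<close>

lemma pos_semidef_sum_rank_one_aux:
  assumes "finite S" "pos_semidef Y" "\<And>i. i \<notin> S \<Longrightarrow> Y $ i = 0"
  shows "\<exists>v :: 'm \<Rightarrow> real ^ 'm. Y = (\<Sum>i\<in>S. \<chi> a b. v i $ a * v i $ b)"
  using assms
proof (induction S arbitrary: Y rule: finite_induct)
  case empty
  then show ?case by (simp add: vec_eq_iff)
next
  case (insert i S)
  have symY: "Y $ a $ b = Y $ b $ a" for a b
    using insert.prems(1) by (simp add: pos_semidef_def sym_matrix_def vec_eq_iff transpose_def)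
  have axis: "axis i 1 \<bullet> (Y *v x) = Y $ i \<bullet> x" for x
    by (simp add: inner_axis' matrix_vector_mul_component)
  have diag: "axis i 1 \<bullet> (Y *v axis i 1) = Y $ i $ i"
    by (simp add: axis inner_axis)
  \<comment> \<open>chosen so that \<open>Y\<close> and \<open>w w\<^sup>T\<close> have the same row \<open>i\<close>\<close>
  define w where "w = (if Y $ i $ i = 0 then 0 else (1 / sqrt (Y $ i $ i)) *\<^sub>R Y $ i)"
  define Z where "Z = Y - (\<chi> a b. w $ a * w $ b)"
  have pos: "0 \<le> Y $ i $ i"
    using insert.prems(1) diag by (metis pos_semidef_def)
  have row0: "Y $ i = 0" if "Y $ i $ i = 0"
  proof -
    have "Y *v axis i 1 = 0"
      using diag that by (intro pos_semidef_kernel[OF insert.prems(1)]) simp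
    then show ?thesis
      by (simp add: vec_eq_iff matrix_vector_mul_component inner_axis symY[of i])
  qed
  have ww: "w $ a * w $ b = (if Y $ i $ i = 0 then 0 else Y $ i $ a * Y $ i $ b / Y $ i $ i)" for a b
    using pos by (simp add: w_def)
  have quad: "x \<bullet> (Z *v x) = x \<bullet> (Y *v x) - (w \<bullet> x)\<^sup>2" for x
  proof -
    have "(\<chi> a b. w $ a * w $ b) *v x = (w \<bullet> x) *\<^sub>R w"
      by (simp add: vec_eq_iff matrix_vector_mult_def inner_vec_def sum_distrib_left sum_distrib_right mult_ac)
    then show ?thesis
      by (simp add: Z_def matrix_vector_mult_diff_rdistrib inner_diff_right power2_eq_square inner_commute)
  qed
  have "pos_semidef Z"
    unfolding pos_semidef_def
  proof (intro conjI allI)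
    show "sym_matrix Z"
      by (simp add: sym_matrix_def Z_def vec_eq_iff transpose_def symY mult.commute)
  next
    fix x
    have "(w \<bullet> x)\<^sup>2 \<le> x \<bullet> (Y *v x)"
    proof (cases "Y $ i $ i = 0")
      case True
      then show ?thesis using insert.prems(1) by (simp add: w_def pos_semidef_def)
    next
      case False
      have "(Y $ i \<bullet> x)\<^sup>2 \<le> Y $ i $ i * (x \<bullet> (Y *v x))"
        using pos_semidef_cauchy_schwarz[OF insert.prems(1), of "axis i 1" x] by (simp only: diag) (simp only: axis)
      moreover have "(w \<bullet> x)\<^sup>2 = (Y $ i \<bullet> x)\<^sup>2 / Y $ i $ i"
        using False pos by (simp add: w_def power_divide)
      ultimately show ?thesis using False pos by (simp add: divide_le_eq mult.commute)
    qed
    then show "0 \<le> x \<bullet> (Z *v x)" by (simp add: quad)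
  qed
  moreover have "Z $ j = 0" if "j \<notin> S" for j
  proof (cases "j = i")
    case True
    then show ?thesis using row0 by (auto simp: Z_def vec_eq_iff ww)
  next
    case False
    then have "Y $ j = 0" using insert.prems(2) that by simp
    then show ?thesis using symY[of i j] by (simp add: Z_def vec_eq_iff ww)
  qed
  ultimately obtain v where v: "Z = (\<Sum>j\<in>S. \<chi> a b. v j $ a * v j $ b)"
    using insert.IH by blast
  have "Y = (\<chi> a b. w $ a * w $ b) + (\<Sum>j\<in>S. \<chi> a b. v j $ a * v j $ b)"
    using v by (simp add: Z_def algebra_simps)
  also have "\<dots> = (\<Sum>j\<in>insert i S. \<chi> a b. (v(i := w)) j $ a * (v(i := w)) j $ b)"
  proof -
    have "(\<Sum>j\<in>S. \<chi> a b. (v(i := w)) j $ a * (v(i := w)) j $ b) = (\<Sum>j\<in>S. \<chi> a b. v j $ a * v j $ b)"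
      using insert.hyps by (intro sum.cong) auto
    then show ?thesis using insert.hyps by simp
  qed
  finally show ?case by blast
qed

lemma pos_semidef_sum_rank_one:
  fixes Y :: "real ^ 'm ^ 'm"
  assumes "pos_semidef Y"
  obtains v :: "'m \<Rightarrow> real ^ 'm" where "Y = (\<Sum>i\<in>UNIV. \<chi> a b. v i $ a * v i $ b)"
  using pos_semidef_sum_rank_one_aux[OF finite_class.finite_UNIV assms] by auto

lemma pos_semidef_norm_le_trace:
  assumes "pos_semidef Y"
  shows "norm Y \<le> trace Y"
proof -
  obtain v :: "'a \<Rightarrow> real ^ 'a" where Y: "Y = (\<Sum>i\<in>UNIV. \<chi> a b. v i $ a * v i $ b)"
    using pos_semidef_sum_rank_one[OF assms] .
  have outer: "norm (\<chi> a b. w $ a * w $ b) = trace (\<chi> a b. w $ a * w $ b)" for w :: "real ^ 'a"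
  proof -
    have "(\<chi> b. w $ a * w $ b) = w $ a *\<^sub>R w" for a by (simp add: vec_eq_iff)
    then have "(norm (\<chi> a b. w $ a * w $ b))\<^sup>2 = (w \<bullet> w)\<^sup>2"
      unfolding power2_norm_eq_inner inner_vec_def[of "\<chi> a. _ a"]
      by (simp add: inner_vec_def[of w w] power2_eq_square sum_distrib_left sum_distrib_right mult_ac)
    then have "norm (\<chi> a b. w $ a * w $ b) = w \<bullet> w" by simp
    then show ?thesis by (simp add: trace_def inner_vec_def)
  qed
  have tr: "trace (\<Sum>i\<in>UNIV. M i) = (\<Sum>i\<in>UNIV. trace (M i))" for M :: "'a \<Rightarrow> real ^ 'a ^ 'a"
    unfolding trace_def by (simp, rule sum.swap)
  show ?thesis
    unfolding Y tr by (rule order_trans[OF norm_sum]) (simp add: outer)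
qed

text \<open>With \<open>Y\<close> a sum of matrices \<open>v v\<^sup>T\<close>, the trace of \<open>Y ** N\<close> is the sum of the nonnegative numbers
  \<open>v \<bullet> (N *v v)\<close>; if it vanishes, each \<open>v\<close> lies in the kernel of \<open>N\<close>. This turns scalar complementarity into the
  matrix equation that the residual measures.\<close>

lemma pos_semidef_mult_eq_zero:
  assumes "pos_semidef Y" "pos_semidef N" "trace (Y ** N) = 0"
  shows "Y ** N = 0"
proof -
  obtain v :: "'a \<Rightarrow> real ^ 'a" where Y: "Y = (\<Sum>i\<in>UNIV. \<chi> a b. v i $ a * v i $ b)"
    using pos_semidef_sum_rank_one[OF assms(1)] .
  have symN: "N $ a $ b = N $ b $ a" for a b
    using assms(2) by (simp add: pos_semidef_def sym_matrix_def vec_eq_iff transpose_def)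
  have YN: "(Y ** N) $ a $ b = (\<Sum>i\<in>UNIV. v i $ a * (N *v v i) $ b)" for a b
  proof -
    have "(Y ** N) $ a $ b = (\<Sum>c\<in>UNIV. \<Sum>i\<in>UNIV. v i $ a * (N $ b $ c * v i $ c))"
      by (simp only: Y matrix_matrix_mult_def sum_distrib_right symN[of _ b] sum_component vec_lambda_beta)
         (simp only: mult_ac)
    also have "\<dots> = (\<Sum>i\<in>UNIV. v i $ a * (N *v v i) $ b)"
      by (subst sum.swap) (simp add: matrix_vector_mult_def sum_distrib_left)
    finally show ?thesis .
  qed
  have "trace (Y ** N) = (\<Sum>i\<in>UNIV. v i \<bullet> (N *v v i))"
    unfolding trace_def YN by (subst sum.swap) (simp add: inner_vec_def)
  then have "(\<Sum>i\<in>UNIV. v i \<bullet> (N *v v i)) = 0" using assms(3) by simp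
  then have "v i \<bullet> (N *v v i) = 0" for i
    using assms(2) by (subst (asm) sum_nonneg_eq_0_iff) (auto simp: pos_semidef_def)
  then have "N *v v i = 0" for i
    using pos_semidef_kernel[OF assms(2)] by blast
  then show ?thesis by (simp add: vec_eq_iff YN)
qed

section \<open>First-order expansion of twice continuously differentiable maps\<close>

lemma twice_cont_diff_differentiable:
  assumes "twice_cont_diff F"
  shows "F differentiable (at x)"
  using assms unfolding twice_cont_diff_def differentiable_def by blast

lemma twice_cont_diff_has_derivative:
  assumes "twice_cont_diff F"
  shows "(F has_derivative frechet_derivative F (at x)) (at x)"
  using twice_cont_diff_differentiable[OF assms] frechet_derivative_works by blast

lemma twice_cont_diff_continuous_on:
  assumes "twice_cont_diff F"
  shows "continuous_on S F"
  using twice_cont_diff_has_derivative[OF assms] has_derivative_continuous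
  by (blast intro: continuous_at_imp_continuous_on)

lemma twice_cont_diff_blinfun:
  assumes "twice_cont_diff F"
  obtains F' F'' where "\<And>x. frechet_derivative F (at x) = blinfun_apply (F' x)"
    "\<And>x. (F' has_derivative blinfun_apply (F'' x)) (at x)" "continuous_on UNIV F''"
proof -
  obtain F' F'' where F: "\<And>x. (F has_derivative blinfun_apply (F' x)) (at x)"
     "\<And>x. (F' has_derivative blinfun_apply (F'' x)) (at x)" "continuous_on UNIV F''"
    using assms unfolding twice_cont_diff_def by auto
  have "frechet_derivative F (at x) = blinfun_apply (F' x)" for x
    using frechet_derivative_at[OF F(1)] by simp
  then show ?thesis using F(2,3) by (rule that)
qed

lemma tendsto_frechet_derivative:
  assumes "twice_cont_diff F" "X \<longlonglongrightarrow> x"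
  shows "(\<lambda>k. frechet_derivative F (at (X k)) v) \<longlonglongrightarrow> frechet_derivative F (at x) v"
proof -
  obtain F' F'' where F: "\<And>x. frechet_derivative F (at x) = blinfun_apply (F' x)"
     "\<And>x. (F' has_derivative blinfun_apply (F'' x)) (at x)"
    using twice_cont_diff_blinfun[OF assms(1)] by metis
  have "isCont F' x" using F(2) by (rule has_derivative_continuous)
  then have "(\<lambda>k. F' (X k)) \<longlonglongrightarrow> F' x" using assms(2) isCont_tendsto_compose by blast
  then show ?thesis unfolding F(1) by (intro blinfun.tendsto tendsto_const)
qed

lemma frechet_derivative_bounded_on_compact:
  assumes "twice_cont_diff F" "compact K"
  obtains M where "0 \<le> M" "\<And>x v. x \<in> K \<Longrightarrow> norm (frechet_derivative F (at x) v) \<le> M * norm v"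
proof -
  obtain F' F'' where F: "\<And>x. frechet_derivative F (at x) = blinfun_apply (F' x)"
     "\<And>x. (F' has_derivative blinfun_apply (F'' x)) (at x)"
    using twice_cont_diff_blinfun[OF assms(1)] by metis
  have "continuous_on K F'"
    using F(2) has_derivative_continuous by (blast intro: continuous_at_imp_continuous_on)
  then have "bounded (F' ` K)"
    using assms(2) compact_continuous_image compact_imp_bounded by blast
  then obtain M where M: "0 < M" "\<And>x. x \<in> K \<Longrightarrow> norm (F' x) \<le> M"
    unfolding bounded_pos by blast
  show ?thesis
  proof (rule that)
    show "0 \<le> M" using M(1) by simp
    show "norm (frechet_derivative F (at x) v) \<le> M * norm v" if "x \<in> K" for x v
      unfolding F(1) using norm_blinfun[of "F' x" v] M(2)[OF that]
      by (meson mult_right_mono norm_ge_zero order_trans)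
  qed
qed

text \<open>The second derivative is bounded on the compact ball, so the derivative is Lipschitz there, and the mean value
  inequality on the segment gives a quadratic remainder, uniformly over the ball.\<close>

lemma taylor_first_order_on_ball:
  fixes F :: "'a::euclidean_space \<Rightarrow> 'b::real_normed_vector"
  assumes "twice_cont_diff F"
  obtains L where "0 \<le> L"
    "\<And>x v. x \<in> cball 0 R \<Longrightarrow> x + v \<in> cball 0 R \<Longrightarrow>
       norm (F (x + v) - F x - frechet_derivative F (at x) v) \<le> L * (norm v)\<^sup>2"
proof -
  obtain F' F'' where F: "\<And>x. frechet_derivative F (at x) = blinfun_apply (F' x)"
     "\<And>x. (F' has_derivative blinfun_apply (F'' x)) (at x)" "continuous_on UNIV F''"
    using twice_cont_diff_blinfun[OF assms] by metis
  let ?K = "cball (0 :: 'a) R"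
  have "bounded (F'' ` ?K)"
    using F(3) by (intro compact_imp_bounded compact_continuous_image continuous_on_subset[OF F(3)]) auto
  then obtain M where M: "0 < M" "\<And>x. x \<in> ?K \<Longrightarrow> norm (F'' x) \<le> M"
    unfolding bounded_pos by blast
  show ?thesis
  proof (rule that)
    show "0 \<le> M" using M(1) by simp
    fix x v :: 'a
    assume xv: "x \<in> ?K" "x + v \<in> ?K"
    let ?S = "closed_segment x (x + v)"
    have sub: "?S \<subseteq> ?K" using xv by (intro closed_segment_subset) auto
    have lip: "onorm (blinfun_apply (F' y) - blinfun_apply (F' x)) \<le> M * norm v" if "y \<in> ?S" for y
    proof -
      have "norm (F' y - F' x) \<le> M * norm (y - x)"
      proof (rule differentiable_bound[where f' = "\<lambda>z. blinfun_apply (F'' z)" and S = ?K])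
        show "(F' has_derivative blinfun_apply (F'' z)) (at z within ?K)" for z
          using F(2) has_derivative_at_withinI by blast
        show "onorm (blinfun_apply (F'' z)) \<le> M" if "z \<in> ?K" for z
          using M(2)[OF that] by (simp add: norm_blinfun.rep_eq)
      qed (use that sub xv in auto)
      also have "\<dots> \<le> M * norm v"
        using segment_bound[OF that] M(1) by (simp add: norm_minus_commute)
      finally show ?thesis
        by (simp add: norm_blinfun.rep_eq minus_blinfun.rep_eq fun_diff_def)
    qed
    have "norm (F (x + v) - F x - blinfun_apply (F' x) (x + v - x)) \<le> norm (x + v - x) * (M * norm v)"
    proof (rule differentiable_bound_linearization[where S = ?S and f' = "\<lambda>z. blinfun_apply (F' z)"])
      show "x + t *\<^sub>R (x + v - x) \<in> ?S" if "t \<in> {0..1}" for t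
        using that by (auto simp: in_segment algebra_simps intro!: exI[of _ t])
      show "(F has_derivative blinfun_apply (F' z)) (at z within ?S)" for z
        using twice_cont_diff_has_derivative[OF assms, of z] F(1) has_derivative_at_withinI by metis
      show "x \<in> ?S" by simp
    qed (rule lip)
    then show "norm (F (x + v) - F x - frechet_derivative F (at x) v) \<le> M * (norm v)\<^sup>2"
      by (simp add: F(1) power2_eq_square mult_ac)
  qed
qed

text \<open>Links the coordinate-wise gradient, Jacobian and \<open>DG\<close> to the Frechet derivative.\<close>

lemma frechet_derivative_cart_sum:
  fixes F :: "real ^ 'n \<Rightarrow> 'b::real_normed_vector"
  assumes "F differentiable (at x)"
  shows "frechet_derivative F (at x) d = (\<Sum>i\<in>UNIV. d $ i *\<^sub>R partial_deriv i F x)"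
proof -
  have lin: "linear (frechet_derivative F (at x))"
    using assms by (rule linear_frechet_derivative)
  have "d = (\<Sum>i\<in>UNIV. d $ i *\<^sub>R axis i 1)"
    using basis_expansion[of d] by (simp add: scalar_mult_eq_scaleR)
  then have "frechet_derivative F (at x) d = frechet_derivative F (at x) (\<Sum>i\<in>UNIV. d $ i *\<^sub>R axis i 1)"
    by simp
  then show ?thesis
    by (simp add: linear_sum[OF lin] linear_cmul[OF lin] partial_deriv_def)
qed

lemma gradient_inner:
  assumes "F differentiable (at x)"
  shows "gradient F x \<bullet> d = frechet_derivative F (at x) d"
  by (simp add: frechet_derivative_cart_sum[OF assms] gradient_def inner_vec_def mult.commute)

lemma Jac_mult:
  assumes "F differentiable (at x)"
  shows "Jac F x *v d = frechet_derivative F (at x) d"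
  unfolding Jac_def
  using frechet_derivative_at[OF assms[unfolded jacobian_works]] by (rule fun_cong)

lemma DG_frechet:
  assumes "F differentiable (at x)"
  shows "DG F x d = frechet_derivative F (at x) d"
  by (simp add: frechet_derivative_cart_sum[OF assms] DG_def)

lemma bounded_linear_DG: "bounded_linear (DG F x)"
  unfolding DG_def by (intro bounded_linear_sum bounded_linear_scaleR_const bounded_linear_vec_nth)

lemma DG_scaleR: "DG F x (c *\<^sub>R d) = c *\<^sub>R DG F x d"
  and DG_zero: "DG F x 0 = 0"
  by (simp_all add: DG_def scaleR_sum_right)

lemma bounded_bilinear_mat_inner: "bounded_bilinear (mat_inner :: real ^ 'm ^ 'm \<Rightarrow> _)"
proof -
  have "bounded_linear (trace :: real ^ 'm ^ 'm \<Rightarrow> real)"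
    unfolding trace_def
    by (intro bounded_linear_sum bounded_linear_compose[OF bounded_linear_vec_nth bounded_linear_vec_nth])
  then interpret tr: bounded_linear "trace :: real ^ 'm ^ 'm \<Rightarrow> real" .
  interpret mm: bounded_bilinear "(**) :: real ^ 'm ^ 'm \<Rightarrow> real ^ 'm ^ 'm \<Rightarrow> _"
    by (rule bounded_bilinear_matrix_mult)
  obtain K where K: "0 \<le> K" "\<And>A B. norm ((A :: real ^ 'm ^ 'm) ** (B :: real ^ 'm ^ 'm)) \<le> norm A * norm B * K"
    using mm.nonneg_bounded by blast
  obtain L where L: "0 \<le> L" "\<And>A. norm (trace (A :: real ^ 'm ^ 'm)) \<le> norm A * L"
    using tr.nonneg_bounded by blast
  have "norm (mat_inner A B) \<le> norm A * norm B * (K * L)" for A B :: "real ^ 'm ^ 'm"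
  proof -
    have "norm (mat_inner A B) \<le> norm (A ** B) * L" unfolding mat_inner_def by (rule L(2))
    also have "\<dots> \<le> norm A * norm B * K * L" by (intro mult_right_mono K L(1))
    finally show ?thesis by (simp only: mult.assoc)
  qed
  then show ?thesis
    by unfold_locales (auto simp: mat_inner_def mm.add_left mm.add_right mm.scaleR_left mm.scaleR_right
        tr.add tr.scaleR)
qed

lemma mat_inner_commute: "mat_inner A B = mat_inner B A"
  unfolding mat_inner_def by (rule trace_mul_sym)

lemma DG_adj_inner: "DG_adj G x Y \<bullet> d = mat_inner Y (DG G x d)"
proof -
  interpret mi: bounded_bilinear "mat_inner :: real ^ 'b ^ 'b \<Rightarrow> _" by (rule bounded_bilinear_mat_inner)
  show ?thesis
    by (simp add: DG_adj_def DG_def inner_vec_def mi.sum_right mi.scaleR_right mat_inner_commute mult.commute)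
qed

lemma gradient_fritz_john_zero:
  assumes h: "h differentiable (at x)" and G: "G differentiable (at x)"
  shows "gradient (\<lambda>z. fritz_john f h G z 0 \<mu> Y) x = transpose (Jac h x) *v \<mu> + DG_adj G x Y"
proof -
  interpret mi: bounded_bilinear "mat_inner :: real ^ 'c ^ 'c \<Rightarrow> _" by (rule bounded_bilinear_mat_inner)
  let ?h' = "frechet_derivative h (at x)" and ?G' = "frechet_derivative G (at x)"
  have "((\<lambda>z. \<mu> \<bullet> h z + mat_inner Y (G z)) has_derivative (\<lambda>d. \<mu> \<bullet> ?h' d + mat_inner Y (?G' d))) (at x)"
    by (intro has_derivative_add has_derivative_inner_right
        bounded_linear.has_derivative[OF mi.bounded_linear_right]
        h[unfolded frechet_derivative_works] G[unfolded frechet_derivative_works])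
  then have der: "((\<lambda>z. fritz_john f h G z 0 \<mu> Y) has_derivative (\<lambda>d. \<mu> \<bullet> ?h' d + mat_inner Y (?G' d))) (at x)"
    by (simp add: fritz_john_def)
  show ?thesis
  proof (rule vector_eq_rdot[THEN iffD1], rule allI)
    fix d
    show "gradient (\<lambda>z. fritz_john f h G z 0 \<mu> Y) x \<bullet> d = (transpose (Jac h x) *v \<mu> + DG_adj G x Y) \<bullet> d"
      using gradient_inner[OF differentiableI[OF der], of d] frechet_derivative_at[OF der]
      by (simp add: inner_add_left DG_adj_inner dot_lmul_matrix Jac_mult[OF h] DG_frechet[OF G]
          flip: fun_cong[OF frechet_derivative_at[OF der]])
  qed
qed

lemma norm1_triangle: "norm1 (a + b) \<le> norm1 a + norm1 b"
  unfolding norm1_def by (simp add: sum_mono abs_triangle_ineq flip: sum.distrib)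

lemma norm1_scaleR: "norm1 (c *\<^sub>R a) = \<bar>c\<bar> * norm1 a"
  by (simp add: norm1_def abs_mult sum_distrib_left)

lemma norm1_le_norm: "norm1 (a :: real ^ 'l) \<le> real CARD('l) * norm a"
  unfolding norm1_def using sum_bounded_above[of UNIV "\<lambda>i. \<bar>a $ i\<bar>" "norm a"] by (simp add: component_le_norm_cart)

section \<open>Decrease of the constraint violation along a step\<close>

lemma lin_violation_zero: "lin_violation h G x 0 = violation h G x"
  by (simp add: lin_violation_def violation_def DG_zero)

text \<open>The linearized violation is convex, so moving a fraction \<open>u\<close> of the step realizes at least the fraction \<open>u\<close> of
  its decrease; the true violation differs by the quadratic remainders of \<open>h\<close> and \<open>G\<close>, since the 1-norm and the
  largest eigenvalue are Lipschitz. Convexity of the largest eigenvalue needs symmetry of the matrix \<open>DG G x d\<close>.\<close>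

lemma violation_descent:
  fixes h :: "real ^ 'n \<Rightarrow> real ^ 'l" and G :: "real ^ 'n \<Rightarrow> real ^ 'm ^ 'm"
  assumes h: "twice_cont_diff h" and G: "twice_cont_diff G" and sym: "\<And>z. sym_matrix (G z)"
  obtains L where "0 \<le> L"
    "\<And>x d u. x \<in> cball 0 R \<Longrightarrow> x + u *\<^sub>R d \<in> cball 0 R \<Longrightarrow> 0 \<le> u \<Longrightarrow> u \<le> 1 \<Longrightarrow> sym_matrix (DG G x d) \<Longrightarrow>
       violation h G (x + u *\<^sub>R d) \<le> violation h G x - u * delta_lin_violation h G x d + L * (norm (u *\<^sub>R d))\<^sup>2"
proof -
  obtain Lh where Lh: "0 \<le> Lh" "\<And>x v. x \<in> cball 0 R \<Longrightarrow> x + v \<in> cball 0 R \<Longrightarrow>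
      norm (h (x + v) - h x - frechet_derivative h (at x) v) \<le> Lh * (norm v)\<^sup>2"
    using taylor_first_order_on_ball[OF h] by blast
  obtain LG where LG: "0 \<le> LG" "\<And>x v. x \<in> cball 0 R \<Longrightarrow> x + v \<in> cball 0 R \<Longrightarrow>
      norm (G (x + v) - G x - frechet_derivative G (at x) v) \<le> LG * (norm v)\<^sup>2"
    using taylor_first_order_on_ball[OF G] by blast
  define L where "L = real CARD('l) * Lh + LG"
  have "0 \<le> L" using Lh(1) LG(1) by (simp add: L_def)
  moreover have "violation h G (x + u *\<^sub>R d)
      \<le> violation h G x - u * delta_lin_violation h G x d + L * (norm (u *\<^sub>R d))\<^sup>2"
    if x: "x \<in> cball 0 R" "x + u *\<^sub>R d \<in> cball 0 R" and u: "0 \<le> u" "u \<le> 1" and symD: "sym_matrix (DG G x d)"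
    for x d u
  proof -
    define q where "q = (norm (u *\<^sub>R d))\<^sup>2"
    define a where "a = h x + Jac h x *v d"
    define e where "e = h (x + u *\<^sub>R d) - h x - Jac h x *v (u *\<^sub>R d)"
    have "norm e \<le> Lh * q"
      unfolding e_def q_def Jac_mult[OF twice_cont_diff_differentiable[OF h]] by (rule Lh(2)[OF x])
    then have e: "norm1 e \<le> real CARD('l) * (Lh * q)"
      by (intro order_trans[OF norm1_le_norm] mult_left_mono) auto
    have "h (x + u *\<^sub>R d) = ((1 - u) *\<^sub>R h x + u *\<^sub>R a) + e"
      by (simp add: e_def a_def algebra_simps matrix_vector_mult_scaleR)
    then have "norm1 (h (x + u *\<^sub>R d)) \<le> norm1 ((1 - u) *\<^sub>R h x) + norm1 (u *\<^sub>R a) + norm1 e"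
      by (metis add_right_mono norm1_triangle order_trans)
    then have hle: "norm1 (h (x + u *\<^sub>R d)) \<le> (1 - u) * norm1 (h x) + u * norm1 a + real CARD('l) * (Lh * q)"
      using e u by (simp add: norm1_scaleR)
    define A where "A = G x + DG G x d"
    define C where "C = (1 - u) *\<^sub>R G x + u *\<^sub>R A"
    have symA: "sym_matrix A" unfolding A_def by (intro sym_matrix_add sym symD)
    have symC: "sym_matrix C" unfolding C_def by (intro sym_matrix_add sym_matrix_scaleR sym symA)
    have "G (x + u *\<^sub>R d) - C = G (x + u *\<^sub>R d) - G x - DG G x (u *\<^sub>R d)"
      by (simp add: C_def A_def DG_scaleR algebra_simps)
    then have "norm (G (x + u *\<^sub>R d) - C) \<le> LG * q"
      unfolding q_def DG_frechet[OF twice_cont_diff_differentiable[OF G]] by (simp only: LG(2)[OF x])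
    then have "lambda_max (G (x + u *\<^sub>R d)) \<le> lambda_max C + LG * q"
      using lambda_max_le_add_norm[OF sym symC, of "x + u *\<^sub>R d"] by linarith
    also have "lambda_max C \<le> (1 - u) * lambda_max (G x) + u * lambda_max A"
      unfolding C_def by (rule lambda_max_convex_combination[OF sym symA u])
    also have "\<dots> \<le> (1 - u) * max 0 (lambda_max (G x)) + u * max 0 (lambda_max A)"
      using u by (intro add_mono mult_left_mono) auto
    finally have "lambda_max (G (x + u *\<^sub>R d)) \<le> (1 - u) * max 0 (lambda_max (G x)) + u * max 0 (lambda_max A) + LG * q"
      by simp
    moreover have "0 \<le> (1 - u) * max 0 (lambda_max (G x)) + u * max 0 (lambda_max A) + LG * q"
      using u LG(1) by (intro add_nonneg_nonneg mult_nonneg_nonneg) (auto simp: q_def)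
    ultimately have Gle: "max 0 (lambda_max (G (x + u *\<^sub>R d)))
        \<le> (1 - u) * max 0 (lambda_max (G x)) + u * max 0 (lambda_max A) + LG * q"
      by simp
    have "violation h G (x + u *\<^sub>R d) \<le> (1 - u) * violation h G x + u * lin_violation h G x d + L * q"
      using hle Gle unfolding violation_def lin_violation_def a_def[symmetric] A_def[symmetric] L_def
      by (simp add: algebra_simps)
    then show ?thesis
      unfolding delta_lin_violation_def lin_violation_zero q_def[symmetric] by (simp add: algebra_simps)
  qed
  ultimately show ?thesis by (rule that)
qed

section \<open>The feasibility subproblem\<close>

text \<open>Eliminating \<open>r\<close>, \<open>s\<close>, \<open>t\<close> turns the subproblem into minimizing the linearized violation plus a quadratic term.\<close>

lemma feas_objective_optimal_slacks:
  fixes h :: "real ^ 'n \<Rightarrow> real ^ 'l" and G :: "real ^ 'n \<Rightarrow> real ^ 'm ^ 'm" and x :: "real ^ 'n"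
  defines "u \<equiv> \<lambda>d. h x + Jac h x *v d"
  shows "feas_objective B (d, pos_part (u d), - neg_part (u d), max 0 (lambda_max (G x + DG G x d)))
    = lin_violation h G x d + 1/2 * (d \<bullet> (B *v d))"
proof -
  have "1 \<bullet> (pos_part v + - neg_part v) = norm1 v" for v :: "real ^ 'l"
    unfolding inner_vec_def norm1_def by (intro sum.cong) (auto simp: pos_part_def neg_part_def)
  then show ?thesis
    by (simp add: feas_objective_def lin_violation_def u_def)
qed

lemma feas_constraints_optimal_slacks:
  assumes "sym_matrix (G x + DG G x d)"
  shows "feas_constraints h G x (d, pos_part (h x + Jac h x *v d), - neg_part (h x + Jac h x *v d),
    max 0 (lambda_max (G x + DG G x d)))"
  using assms
  by (auto simp: feas_constraints_def loewner_le_scaled_identity_iff vec_eq_iff less_eq_vec_def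
      pos_part_def neg_part_def)

text \<open>For fixed \<open>d\<close>, the positive part and the negated negative part of the linearization of \<open>h\<close> and the positive
  part of the largest eigenvalue are the smallest feasible slacks, simultaneously in all components, and the objective is strictly increasing in each slack.\<close>

lemma feas_argmin_slacks:
  fixes h :: "real ^ 'n \<Rightarrow> real ^ 'l" and G :: "real ^ 'n \<Rightarrow> real ^ 'm ^ 'm"
  assumes min: "is_arg_min (feas_objective B) (feas_constraints h G x) (d, r, s, t)"
  shows "sym_matrix (G x + DG G x d)" "h x + Jac h x *v d = r - s"
    "r = pos_part (h x + Jac h x *v d)" "s = - neg_part (h x + Jac h x *v d)"
    "t = max 0 (lambda_max (G x + DG G x d))"
proof -
  define u where "u = h x + Jac h x *v d"
  define t' where "t' = max 0 (lambda_max (G x + DG G x d))"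
  have feas: "feas_constraints h G x (d, r, s, t)"
    using min by (simp add: is_arg_min_def)
  then show sym: "sym_matrix (G x + DG G x d)" and rs: "h x + Jac h x *v d = r - s"
    by (auto simp: feas_constraints_def loewner_le_scaled_identity_iff)
  have urs: "u $ i = r $ i - s $ i" and r0: "0 \<le> r $ i" and s0: "0 \<le> s $ i" for i
    using feas by (auto simp: feas_constraints_def u_def less_eq_vec_def)
  have t't: "t' \<le> t"
    using feas by (auto simp: feas_constraints_def t'_def loewner_le_scaled_identity_iff)
  have "feas_constraints h G x (d, pos_part u, - neg_part u, t')"
    unfolding u_def t'_def by (rule feas_constraints_optimal_slacks[OF sym])
  then have "feas_objective B (d, r, s, t) \<le> feas_objective B (d, pos_part u, - neg_part u, t')"
    using min by (auto simp: is_arg_min_def not_less)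
  then have le: "(\<Sum>i\<in>UNIV. r $ i + s $ i) + t \<le> (\<Sum>i\<in>UNIV. pos_part u $ i - neg_part u $ i) + t'"
    by (simp add: feas_objective_def inner_vec_def)
  have comp: "pos_part u $ i \<le> r $ i" "- neg_part u $ i \<le> s $ i" for i
    using urs[of i] r0[of i] s0[of i] by (auto simp: pos_part_def neg_part_def)
  have sum_le: "(\<Sum>i\<in>UNIV. pos_part u $ i - neg_part u $ i) \<le> (\<Sum>i\<in>UNIV. r $ i + s $ i)"
  proof (rule sum_mono)
    show "pos_part u $ i - neg_part u $ i \<le> r $ i + s $ i" for i
      using comp[of i] by linarith
  qed
  show "t = max 0 (lambda_max (G x + DG G x d))"
    using le sum_le t't unfolding t'_def[symmetric] by linarith
  define w where "w = (\<lambda>i. (r $ i + s $ i) - (pos_part u $ i - neg_part u $ i))"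
  have "sum w UNIV = 0"
  proof -
    have "sum w UNIV = (\<Sum>i\<in>UNIV. r $ i + s $ i) - (\<Sum>i\<in>UNIV. pos_part u $ i - neg_part u $ i)"
      by (simp only: w_def sum_subtractf)
    then show ?thesis using le sum_le t't by linarith
  qed
  moreover have "0 \<le> w i" for i using comp[of i] by (simp add: w_def)
  ultimately have w0: "w i = 0" for i by (simp add: sum_nonneg_eq_0_iff)
  have "r $ i = pos_part u $ i \<and> s $ i = - neg_part u $ i" for i
    using comp[of i] w0[of i] unfolding w_def by linarith
  then show "r = pos_part (h x + Jac h x *v d)" "s = - neg_part (h x + Jac h x *v d)"
    by (simp_all add: vec_eq_iff u_def)
qed

text \<open>Compare the minimizer with the zero step, whose objective value is the current violation.\<close>

lemma feas_step_decrease: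
  assumes min: "is_arg_min (feas_objective B) (feas_constraints h G x) (d, r, s, t)"
    and sym: "sym_matrix (G x)"
  shows "1/2 * (d \<bullet> (B *v d)) \<le> delta_lin_violation h G x d"
proof -
  have "feas_objective B (d, r, s, t) = lin_violation h G x d + 1/2 * (d \<bullet> (B *v d))"
    unfolding feas_objective_optimal_slacks[of B d h x G, symmetric] feas_argmin_slacks(3-5)[OF min, symmetric] ..
  moreover have "feas_objective B (d, r, s, t) \<le> lin_violation h G x 0 + 1/2 * (0 \<bullet> (B *v 0))"
    unfolding feas_objective_optimal_slacks[of B 0 h x G, symmetric]
  proof (rule min[unfolded is_arg_min_linorder, THEN conjunct2, rule_format])
    show "feas_constraints h G x (0, pos_part (h x + Jac h x *v 0), - neg_part (h x + Jac h x *v 0),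
      max 0 (lambda_max (G x + DG G x 0)))"
      by (rule feas_constraints_optimal_slacks) (simp add: DG_zero sym)
  qed
  ultimately show ?thesis by (simp add: delta_lin_violation_def)
qed

text \<open>The second subproblem fixes the slacks of the first one, so none of its feasible steps has a larger linearized
  violation.\<close>

lemma opt_constraints_lin_violation_le:
  assumes min: "is_arg_min (feas_objective B) (feas_constraints h G x) (d0, r, s, t)"
    and d: "opt_constraints h G x r s t d"
  shows "lin_violation h G x d \<le> lin_violation h G x d0"
proof -
  have "h x + Jac h x *v d = h x + Jac h x *v d0"
    using d feas_argmin_slacks(2)[OF min] by (simp add: opt_constraints_def)
  moreover have "lambda_max (G x + DG G x d) \<le> max 0 (lambda_max (G x + DG G x d0))"
    using d unfolding feas_argmin_slacks(5)[OF min, symmetric]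
    by (simp add: opt_constraints_def loewner_le_scaled_identity_iff)
  ultimately show ?thesis by (simp add: lin_violation_def)
qed

text \<open>The derivative of the Lagrangian in an arbitrary direction is zero; the four equations are obtained from the
  directions that change only \<open>d\<close>, \<open>r\<close>, \<open>s\<close> or \<open>t\<close>.\<close>

lemma feas_lagrangian_stationary:
  fixes h :: "real ^ 'n \<Rightarrow> real ^ 'l" and G :: "real ^ 'n \<Rightarrow> real ^ 'm ^ 'm"
  assumes sym: "sym_matrix B"
    and stat: "GDERIV (feas_lagrangian h G B x \<mu> Y \<nu>r \<nu>s \<nu>t) (d, r, s, t) :> 0"
  shows "B *v d + transpose (Jac h x) *v \<mu> + DG_adj G x Y = 0"
    "1 - \<mu> = \<nu>r" "1 + \<mu> = \<nu>s" "1 - trace Y = \<nu>t"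
proof -
  interpret mi: bounded_bilinear "mat_inner :: real ^ 'm ^ 'm \<Rightarrow> _" by (rule bounded_bilinear_mat_inner)
  let ?L = "feas_lagrangian h G B x \<mu> Y \<nu>r \<nu>s \<nu>t"
  define D where "D = (\<lambda>q. 1 \<bullet> (fst (snd q) + fst (snd (snd q))) + snd (snd (snd q))
      + 1/2 * (fst (d, r, s, t) \<bullet> (B *v fst q) + fst q \<bullet> (B *v fst (d, r, s, t)))
      + \<mu> \<bullet> (0 + Jac h x *v fst q - fst (snd q) + fst (snd (snd q)))
      + mat_inner Y (0 + DG G x (fst q) - snd (snd (snd q)) *\<^sub>R mat 1)
      - \<nu>r \<bullet> fst (snd q) - \<nu>s \<bullet> fst (snd (snd q)) - \<nu>t * snd (snd (snd q)))"
  have L: "?L = (\<lambda>p. 1 \<bullet> (fst (snd p) + fst (snd (snd p))) + snd (snd (snd p))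
      + 1/2 * (fst p \<bullet> (B *v fst p))
      + \<mu> \<bullet> (h x + Jac h x *v fst p - fst (snd p) + fst (snd (snd p)))
      + mat_inner Y (G x + DG G x (fst p) - snd (snd (snd p)) *\<^sub>R mat 1)
      - \<nu>r \<bullet> fst (snd p) - \<nu>s \<bullet> fst (snd (snd p)) - \<nu>t * snd (snd (snd p)))"
    by (auto simp: feas_lagrangian_def feas_objective_def)
  have "(?L has_derivative D) (at (d, r, s, t))"
    unfolding L D_def
    by (intro has_derivative_add has_derivative_diff has_derivative_inner has_derivative_inner_right
        has_derivative_mult_right has_derivative_scaleR_left has_derivative_fst has_derivative_snd
        has_derivative_const has_derivative_ident bounded_linear.has_derivative[OF matrix_vector_mul_bounded_linear]
        bounded_linear.has_derivative[OF bounded_linear_DG]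
        bounded_linear.has_derivative[OF mi.bounded_linear_right])
  moreover have "(?L has_derivative (\<lambda>q. 0)) (at (d, r, s, t))"
    using stat unfolding gderiv_def by simp
  ultimately have "D = (\<lambda>q. 0)" by (rule has_derivative_unique)
  then have "D (d', r', s', t') = 0" for d' r' s' t' by simp
  then have D: "1 \<bullet> (r' + s') + t' + 1/2 * (d \<bullet> (B *v d') + d' \<bullet> (B *v d))
      + \<mu> \<bullet> (Jac h x *v d' - r' + s') + mat_inner Y (DG G x d' - t' *\<^sub>R mat 1)
      - \<nu>r \<bullet> r' - \<nu>s \<bullet> s' - \<nu>t * t' = 0" for d' r' s' t'
    unfolding D_def by (simp only: fst_conv snd_conv add_0_left)
  have "\<forall>d'. (B *v d + transpose (Jac h x) *v \<mu> + DG_adj G x Y) \<bullet> d' = 0 \<bullet> d'"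
  proof
    fix d'
    have "d \<bullet> (B *v d') = (B *v d) \<bullet> d'" "d' \<bullet> (B *v d) = (B *v d) \<bullet> d'"
      by (rule sym_matrix_inner[OF sym], rule inner_commute)
    then show "(B *v d + transpose (Jac h x) *v \<mu> + DG_adj G x Y) \<bullet> d' = 0 \<bullet> d'"
      using D[of 0 0 0 d'] by (simp add: inner_add_left DG_adj_inner dot_lmul_matrix)
  qed
  then show "B *v d + transpose (Jac h x) *v \<mu> + DG_adj G x Y = 0"
    by (rule iffD1[OF vector_eq_rdot])
  have "\<forall>r'. (1 - \<mu>) \<bullet> r' = \<nu>r \<bullet> r'"
    using D[of _ 0 0 0] by (simp add: inner_diff_left DG_zero mi.zero_right)
  then show "1 - \<mu> = \<nu>r" by (rule iffD1[OF vector_eq_rdot])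
  have "\<forall>s'. (1 + \<mu>) \<bullet> s' = \<nu>s \<bullet> s'"
    using D[of 0 _ 0 0] by (simp add: inner_add_left DG_zero mi.zero_right)
  then show "1 + \<mu> = \<nu>s" by (rule iffD1[OF vector_eq_rdot])
  show "1 - trace Y = \<nu>t"
    using D[of 0 0 1 0] by (simp add: DG_zero mi.minus_right) (simp add: mat_inner_def)
qed

text \<open>The multipliers of the sign constraints are eliminated: they equal \<open>1 - \<mu>\<close>, \<open>1 + \<mu>\<close> and \<open>1 - trace Y\<close>, which
  yields the bounds on \<open>\<mu>\<close> and \<open>Y\<close> as well as the complementarity conditions.\<close>

lemma feas_step_kkt:
  assumes step: "feas_step h G B x d r s t \<mu> Y" and sym: "sym_matrix B"
  shows "pos_semidef Y" "- 1 \<le> \<mu>" "\<mu> \<le> 1" "trace Y \<le> 1"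
    "transpose (Jac h x) *v \<mu> + DG_adj G x Y = - (B *v d)"
    "(1 - \<mu>) * r = 0" "(1 + \<mu>) * s = 0" "(1 - trace Y) * t = 0"
    "Y ** (G x + DG G x d - t *\<^sub>R mat 1) = 0"
proof -
  have min: "is_arg_min (feas_objective B) (feas_constraints h G x) (d, r, s, t)"
    and mult: "feas_multipliers h G B x d r s t \<mu> Y"
    using step by (simp_all add: feas_step_def)
  show psdY: "pos_semidef Y" using mult by (simp add: feas_multipliers_def)
  have feas: "h x + Jac h x *v d = r - s" "G x + DG G x d \<preceq> t *\<^sub>R mat 1" "0 \<le> r" "0 \<le> s"
    using min by (auto simp: is_arg_min_def feas_constraints_def)
  obtain \<nu>r \<nu>s \<nu>t where \<nu>: "0 \<le> \<nu>r" "0 \<le> \<nu>s" "0 \<le> \<nu>t" "\<nu>r \<bullet> r = 0" "\<nu>s \<bullet> s = 0" "\<nu>t * t = 0"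
    and stat: "GDERIV (feas_lagrangian h G B x \<mu> Y \<nu>r \<nu>s \<nu>t) (d, r, s, t) :> 0"
    using mult by (auto simp: feas_multipliers_def)
  note st = feas_lagrangian_stationary[OF sym stat]
  have compl: "a * b = 0" if "0 \<le> a" "0 \<le> b" "a \<bullet> b = 0" for a b :: "real ^ 'b"
  proof -
    have "(\<Sum>i\<in>UNIV. a $ i * b $ i) = 0" using that(3) by (simp add: inner_vec_def)
    then have "a $ i * b $ i = 0" for i
      using that(1,2) by (subst (asm) sum_nonneg_eq_0_iff) (auto simp: less_eq_vec_def)
    then show ?thesis by (simp add: vec_eq_iff)
  qed
  show "- 1 \<le> \<mu>" "\<mu> \<le> 1" "trace Y \<le> 1"
    using \<nu>(1,2,3) unfolding st(2)[symmetric] st(3)[symmetric] st(4)[symmetric] less_eq_vec_def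
    by (simp_all, smt (verit))
  show "transpose (Jac h x) *v \<mu> + DG_adj G x Y = - (B *v d)"
    using st(1) by (simp add: eq_neg_iff_add_eq_0 add.commute add.left_commute del: vector_transpose_matrix transpose_matrix_vector)
  show "(1 - \<mu>) * r = 0" "(1 + \<mu>) * s = 0" "(1 - trace Y) * t = 0"
    unfolding st(2-4) using compl[OF \<nu>(1) feas(3) \<nu>(4)] compl[OF \<nu>(2) feas(4) \<nu>(5)] \<nu>(6) by simp_all
  define N where "N = t *\<^sub>R mat 1 - (G x + DG G x d)"
  have neg: "G x + DG G x d - t *\<^sub>R mat 1 = - N" by (simp add: N_def)
  interpret mm: bounded_bilinear "(**) :: real ^ 'c ^ 'c \<Rightarrow> real ^ 'c ^ 'c \<Rightarrow> _"
    by (rule bounded_bilinear_matrix_mult)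
  interpret mi: bounded_bilinear "mat_inner :: real ^ 'c ^ 'c \<Rightarrow> _" by (rule bounded_bilinear_mat_inner)
  have "mat_inner Y (- N) = 0"
    using mult unfolding neg[symmetric] by (simp add: feas_multipliers_def)
  then have "Y ** N = 0"
    using feas(2) psdY unfolding loewner_le_def N_def[symmetric]
    by (intro pos_semidef_mult_eq_zero) (simp_all add: mi.minus_right mat_inner_def[symmetric])
  then show "Y ** (G x + DG G x d - t *\<^sub>R mat 1) = 0"
    unfolding neg mm.minus_right by simp
qed

section \<open>The feasibility residual\<close>

text \<open>Each term of the residual vanishes when \<open>h x\<close> and \<open>G x\<close> are replaced by their linearizations at \<open>d\<close> (for the
  gradient term, up to \<open>B *v d\<close>). The positive part, the negative part and the largest eigenvalue are Lipschitz, and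
  \<open>\<mu>\<close> and \<open>Y\<close> are bounded by the sign conditions on the multipliers, so the replacement costs a multiple of
  \<open>norm d\<close>.\<close>

lemma feas_residual_le_step:
  fixes h :: "real ^ 'n \<Rightarrow> real ^ 'l" and G :: "real ^ 'n \<Rightarrow> real ^ 'm ^ 'm"
  assumes step: "feas_step h G B x d r s t \<mu> Y" and symB: "sym_matrix B"
    and h: "h differentiable (at x)" and G: "G differentiable (at x)" and symG: "sym_matrix (G x)"
    and B: "norm (B *v d) \<le> b * norm d"
    and Mh: "norm (Jac h x *v d) \<le> Mh * norm d" and MG: "norm (DG G x d) \<le> MG * norm d"
  shows "feas_residual f h G x \<mu> Y \<le> (b + 4 * Mh + (2 + norm (mat 1 :: real ^ 'm ^ 'm)) * MG) * norm d"
proof -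
  note kkt = feas_step_kkt[OF step symB]
  have min: "is_arg_min (feas_objective B) (feas_constraints h G x) (d, r, s, t)"
    using step by (simp add: feas_step_def)
  note slack = feas_argmin_slacks[OF min]
  define u where "u = h x + Jac h x *v d"
  have u: "u $ i = h x $ i + (Jac h x *v d) $ i" for i by (simp add: u_def)
  have mu: "-1 \<le> \<mu> $ i" "\<mu> $ i \<le> 1" for i
    using kkt(2,3) by (simp_all add: less_eq_vec_def)
  have "infnorm (gradient (\<lambda>z. fritz_john f h G z 0 \<mu> Y) x) \<le> norm (- (B *v d))"
    unfolding gradient_fritz_john_zero[OF h G] kkt(5) by (rule infnorm_le_norm)
  then have 1: "infnorm (gradient (\<lambda>z. fritz_john f h G z 0 \<mu> Y) x) \<le> b * norm d"
    using B by simp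
  have two: "infnorm v \<le> 2 * (Mh * norm d)"
    if "\<And>i. \<bar>v $ i\<bar> \<le> 2 * \<bar>(Jac h x *v d) $ i\<bar>" for v :: "real ^ 'l"
  proof -
    have "norm v \<le> norm (2 *\<^sub>R (Jac h x *v d))"
    proof (rule norm_le_componentwise_cart)
      show "norm (v $ i) \<le> norm ((2 *\<^sub>R (Jac h x *v d)) $ i)" for i
        using that[of i] by (simp add: abs_mult)
    qed
    then show ?thesis
      using infnorm_le_norm[of v] Mh by simp
  qed
  have 2: "infnorm ((1 - \<mu>) * pos_part (h x)) \<le> 2 * (Mh * norm d)"
  proof (rule two)
    fix i
    have "(1 - \<mu> $ i) * max 0 (u $ i) = 0"
      using kkt(6) unfolding slack(3) u_def[symmetric] by (simp add: vec_eq_iff pos_part_def)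
    then have "((1 - \<mu>) * pos_part (h x)) $ i = (1 - \<mu> $ i) * (max 0 (h x $ i) - max 0 (u $ i))"
      by (simp add: pos_part_def right_diff_distrib)
    then have "\<bar>((1 - \<mu>) * pos_part (h x)) $ i\<bar> = \<bar>1 - \<mu> $ i\<bar> * \<bar>max 0 (h x $ i) - max 0 (u $ i)\<bar>"
      by (simp only: abs_mult)
    also have "\<bar>1 - \<mu> $ i\<bar> = 1 - \<mu> $ i" using mu[of i] by simp
    also have "(1 - \<mu> $ i) * \<bar>max 0 (h x $ i) - max 0 (u $ i)\<bar> \<le> 2 * \<bar>(Jac h x *v d) $ i\<bar>"
      using mu[of i] u[of i] by (intro mult_mono) auto
    finally show "\<bar>((1 - \<mu>) * pos_part (h x)) $ i\<bar> \<le> 2 * \<bar>(Jac h x *v d) $ i\<bar>" .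
  qed
  have 3: "infnorm ((1 + \<mu>) * neg_part (h x)) \<le> 2 * (Mh * norm d)"
  proof (rule two)
    fix i
    have "(1 + \<mu> $ i) * min 0 (u $ i) = 0"
      using kkt(7) unfolding slack(4) u_def[symmetric] by (simp add: vec_eq_iff neg_part_def)
    then have "((1 + \<mu>) * neg_part (h x)) $ i = (1 + \<mu> $ i) * (min 0 (h x $ i) - min 0 (u $ i))"
      by (simp add: neg_part_def right_diff_distrib)
    then have "\<bar>((1 + \<mu>) * neg_part (h x)) $ i\<bar> = \<bar>1 + \<mu> $ i\<bar> * \<bar>min 0 (h x $ i) - min 0 (u $ i)\<bar>"
      by (simp only: abs_mult)
    also have "\<bar>1 + \<mu> $ i\<bar> = 1 + \<mu> $ i" using mu[of i] by simp
    also have "(1 + \<mu> $ i) * \<bar>min 0 (h x $ i) - min 0 (u $ i)\<bar> \<le> 2 * \<bar>(Jac h x *v d) $ i\<bar>"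
      using mu[of i] u[of i] by (intro mult_mono) auto
    finally show "\<bar>((1 + \<mu>) * neg_part (h x)) $ i\<bar> \<le> 2 * \<bar>(Jac h x *v d) $ i\<bar>" .
  qed
  have trY: "0 \<le> trace Y" "norm Y \<le> 1"
    using pos_semidef_norm_le_trace[OF kkt(1)] kkt(4) norm_ge_zero[of Y] by linarith+
  define l where "l = max 0 (lambda_max (G x))"
  have "\<bar>lambda_max (G x) - lambda_max (G x + DG G x d)\<bar> \<le> norm (DG G x d)"
    using lambda_max_lipschitz[OF symG slack(1)] by simp
  then have lt: "\<bar>l - t\<bar> \<le> MG * norm d"
    unfolding l_def slack(5) using MG by linarith
  have "\<bar>1 - trace Y\<bar> * l = (1 - trace Y) * (l - t)"
    using kkt(4,8) by (simp add: right_diff_distrib)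
  also have "\<dots> \<le> (1 - trace Y) * \<bar>l - t\<bar>"
    using kkt(4) by (intro mult_left_mono) auto
  also have "\<dots> \<le> 1 * \<bar>l - t\<bar>"
    using trY(1) by (intro mult_right_mono) auto
  finally have 4: "\<bar>1 - trace Y\<bar> * l \<le> MG * norm d"
    using lt by simp
  interpret mm: bounded_bilinear "(**) :: real ^ 'm ^ 'm \<Rightarrow> real ^ 'm ^ 'm \<Rightarrow> _"
    by (rule bounded_bilinear_matrix_mult)
  have "G x - l *\<^sub>R mat 1 = (G x + DG G x d - t *\<^sub>R mat 1) - (DG G x d + (l - t) *\<^sub>R mat 1)"
    by (simp add: algebra_simps)
  then have "Y ** (G x - l *\<^sub>R mat 1) = - (Y ** (DG G x d + (l - t) *\<^sub>R mat 1))"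
    by (simp only: mm.diff_right[of Y "G x + DG G x d - t *\<^sub>R mat 1"] kkt(9) diff_0)
  then have "norm (Y ** (G x - l *\<^sub>R mat 1)) \<le> norm Y * norm (DG G x d + (l - t) *\<^sub>R mat 1)"
    by (simp add: norm_matrix_mult_le)
  also have "\<dots> \<le> 1 * (norm (DG G x d) + \<bar>l - t\<bar> * norm (mat 1 :: real ^ 'm ^ 'm))"
    using trY(2) norm_triangle_ineq[of "DG G x d" "(l - t) *\<^sub>R mat 1"] by (intro mult_mono) auto
  also have "\<dots> \<le> 1 * (MG * norm d + MG * norm d * norm (mat 1 :: real ^ 'm ^ 'm))"
    using MG lt by (intro mult_left_mono add_mono mult_right_mono) auto
  finally have 5: "norm (Y ** (G x - l *\<^sub>R mat 1)) \<le> MG * norm d + MG * norm d * norm (mat 1 :: real ^ 'm ^ 'm)"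
    by simp
  show ?thesis
    unfolding feas_residual_def l_def[symmetric]
    using add_mono[OF add_mono[OF add_mono[OF add_mono[OF 1 2] 3] 4] 5] by (simp add: algebra_simps)
qed

lemma feas_residual_nonneg: "0 \<le> feas_residual f h G x \<mu> Y"
  unfolding feas_residual_def by (intro add_nonneg_nonneg) (auto simp: infnorm_pos_le)

lemma feas_residual_zero_imp_first_order:
  assumes h: "h differentiable (at x)" and G: "G differentiable (at x)"
    and zero: "feas_residual f h G x \<mu> Y = 0"
    and mult: "- 1 \<le> \<mu>" "\<mu> \<le> 1" "pos_semidef Y" "trace Y \<le> 1"
  shows "violation_first_order h G x \<mu> Y"
proof -
  have nn: "0 \<le> infnorm (gradient (\<lambda>z. fritz_john f h G z 0 \<mu> Y) x)"
    "0 \<le> infnorm ((1 - \<mu>) * pos_part (h x))" "0 \<le> infnorm ((1 + \<mu>) * neg_part (h x))"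
    "0 \<le> \<bar>1 - trace Y\<bar> * max 0 (lambda_max (G x))"
    "0 \<le> norm (Y ** (G x - max 0 (lambda_max (G x)) *\<^sub>R mat 1))"
    by (simp_all add: infnorm_pos_le)
  have "infnorm (gradient (\<lambda>z. fritz_john f h G z 0 \<mu> Y) x) = 0"
    "infnorm ((1 - \<mu>) * pos_part (h x)) = 0" "infnorm ((1 + \<mu>) * neg_part (h x)) = 0"
    "\<bar>1 - trace Y\<bar> * max 0 (lambda_max (G x)) = 0"
    "norm (Y ** (G x - max 0 (lambda_max (G x)) *\<^sub>R mat 1)) = 0"
    using zero nn unfolding feas_residual_def by linarith+
  then show ?thesis
    unfolding violation_first_order_def gradient_fritz_john_zero[OF h G]
    using mult by (simp add: infnorm_eq_0 mat_inner_def trace_0[unfolded mat_0])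
qed

lemma tendsto_feas_residual:
  fixes h :: "real ^ 'n \<Rightarrow> real ^ 'l" and G :: "real ^ 'n \<Rightarrow> real ^ 'm ^ 'm"
  assumes h: "twice_cont_diff h" and G: "twice_cont_diff G" and sym: "\<And>z. sym_matrix (G z)"
    and X: "X \<longlonglongrightarrow> x" and M: "M \<longlonglongrightarrow> \<mu>" and Z: "Z \<longlonglongrightarrow> Y"
  shows "(\<lambda>k. feas_residual f h G (X k) (M k) (Z k)) \<longlonglongrightarrow> feas_residual f h G x \<mu> Y"
proof -
  interpret mm: bounded_bilinear "(**) :: real ^ 'm ^ 'm \<Rightarrow> real ^ 'm ^ 'm \<Rightarrow> _"
    by (rule bounded_bilinear_matrix_mult)
  interpret mi: bounded_bilinear "mat_inner :: real ^ 'm ^ 'm \<Rightarrow> _" by (rule bounded_bilinear_mat_inner)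
  have dh: "h differentiable (at z)" and dG: "G differentiable (at z)" for z
    using h G by (simp_all add: twice_cont_diff_differentiable)
  have hX: "(\<lambda>k. h (X k)) \<longlonglongrightarrow> h x" and GX: "(\<lambda>k. G (X k)) \<longlonglongrightarrow> G x"
    by (rule isCont_tendsto_compose[OF differentiable_imp_continuous_within X], rule dh)
       (rule isCont_tendsto_compose[OF differentiable_imp_continuous_within X], rule dG)
  have lam: "(\<lambda>k. lambda_max (G (X k))) \<longlonglongrightarrow> lambda_max (G x)"
  proof (rule LIM_zero_cancel, rule tendsto_rabs_zero_cancel)
    have "(\<lambda>k. norm (G (X k) - G x)) \<longlonglongrightarrow> 0"
      using GX by (intro tendsto_norm_zero LIM_zero)
    then show "(\<lambda>k. \<bar>lambda_max (G (X k)) - lambda_max (G x)\<bar>) \<longlonglongrightarrow> 0"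
      by (rule tendsto_sandwich[OF _ _ tendsto_const, rotated 2])
         (auto intro!: always_eventually lambda_max_lipschitz sym)
  qed
  have lplus: "(\<lambda>k. max 0 (lambda_max (G (X k)))) \<longlonglongrightarrow> max 0 (lambda_max (G x))"
    by (intro tendsto_max tendsto_const lam)
  have comp: "(gradient (\<lambda>z. fritz_john f h G z 0 \<nu> W) z) $ i
      = \<nu> \<bullet> frechet_derivative h (at z) (axis i 1) + mat_inner W (frechet_derivative G (at z) (axis i 1))" for \<nu> W z i
  proof -
    have "(gradient (\<lambda>z. fritz_john f h G z 0 \<nu> W) z) $ i
      = (transpose (Jac h z) *v \<nu> + DG_adj G z W) \<bullet> axis i 1"
      unfolding gradient_fritz_john_zero[OF dh dG] by (simp add: inner_axis)
    also have "\<dots> = \<nu> \<bullet> (Jac h z *v axis i 1) + mat_inner W (DG G z (axis i 1))"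
      by (simp add: inner_add_left dot_lmul_matrix DG_adj_inner del: matrix_vector_mul_component)
    finally show ?thesis by (simp only: Jac_mult[OF dh] DG_frechet[OF dG])
  qed
  have "(\<lambda>k. gradient (\<lambda>z. fritz_john f h G z 0 (M k) (Z k)) (X k)) \<longlonglongrightarrow> gradient (\<lambda>z. fritz_john f h G z 0 \<mu> Y) x"
    by (rule vec_tendstoI)
       (unfold comp, intro tendsto_add tendsto_inner mi.tendsto M Z tendsto_frechet_derivative h G X)
  moreover have "(\<lambda>k. (1 - M k) * pos_part (h (X k))) \<longlonglongrightarrow> (1 - \<mu>) * pos_part (h x)"
    "(\<lambda>k. (1 + M k) * neg_part (h (X k))) \<longlonglongrightarrow> (1 + \<mu>) * neg_part (h x)"
    by (rule vec_tendstoI, simp add: pos_part_def neg_part_def,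
        intro tendsto_intros M hX)+
  moreover have "(\<lambda>k. trace (Z k)) \<longlonglongrightarrow> trace Y"
    unfolding trace_def by (intro tendsto_intros Z)
  ultimately show ?thesis
    unfolding feas_residual_def
    by (intro tendsto_add tendsto_mult tendsto_rabs tendsto_diff tendsto_const tendsto_infnorm tendsto_norm
        mm.tendsto lplus GX Z tendsto_scaleR)
qed

lemma pos_semidef_limit:
  assumes "\<And>k. pos_semidef (Z k)" "Z \<longlonglongrightarrow> Y"
  shows "pos_semidef Y"
proof -
  have comp: "(\<lambda>k. Z k $ i $ j) \<longlonglongrightarrow> Y $ i $ j" for i j
    by (intro tendsto_vec_nth assms(2))
  have "Y $ j $ i = Y $ i $ j" for i j
  proof (rule LIMSEQ_unique[OF comp])
    have "Z k $ j $ i = Z k $ i $ j" for k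
      using assms(1)[of k] by (simp add: pos_semidef_def sym_matrix_def vec_eq_iff transpose_def)
    then show "(\<lambda>k. Z k $ j $ i) \<longlonglongrightarrow> Y $ i $ j" using comp[of i j] by simp
  qed
  then have "sym_matrix Y" by (simp add: sym_matrix_def vec_eq_iff transpose_def)
  moreover have "0 \<le> v \<bullet> (Y *v v)" for v
  proof (rule LIMSEQ_le_const)
    show "(\<lambda>k. v \<bullet> (Z k *v v)) \<longlonglongrightarrow> v \<bullet> (Y *v v)"
      unfolding matrix_vector_mult_def by (intro tendsto_inner tendsto_const vec_tendstoI) (simp, intro tendsto_intros comp)
    show "\<exists>N. \<forall>n\<ge>N. 0 \<le> v \<bullet> (Z n *v v)"
      using assms(1) by (auto simp: pos_semidef_def)
  qed
  ultimately show ?thesis by (simp add: pos_semidef_def)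
qed

section \<open>Penalty parameter and line search\<close>

lemma lin_violation_nonneg: "0 \<le> lin_violation h G x d"
  by (simp add: lin_violation_def norm1_def sum_nonneg)

lemma violation_nonneg: "0 \<le> violation h G x"
  by (simp add: violation_def norm1_def sum_nonneg)

lemma violation_le_norms:
  fixes h :: "real ^ 'n \<Rightarrow> real ^ 'l"
  assumes "sym_matrix (G x)"
  shows "violation h G x \<le> real CARD('l) * norm (h x) + norm (G x)"
proof -
  have "lambda_max (G x) \<le> norm (G x)"
    by (simp add: lambda_max_le_iff[OF assms] quadratic_form_le_norm)
  then show ?thesis
    unfolding violation_def by (intro add_mono norm1_le_norm) simp
qed

text \<open>If the update is triggered, one of the two multiplier sums is positive, so the quotient in the update is a
  positive number and not a division by zero.\<close>

lemma penalty_multiplier_update_pos: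
  assumes "0 < \<delta>" "\<delta> < 1" "\<epsilon> < 1" "0 < \<rho>" "0 \<le> trace Ybar" "0 \<le> trace Yhat"
  shows "0 < penalty_multiplier_update \<epsilon> \<delta> \<rho> \<mu>bar Ybar \<mu>hat Yhat"
    "penalty_multiplier_update \<epsilon> \<delta> \<rho> \<mu>bar Ybar \<mu>hat Yhat \<le> \<rho>"
proof -
  define a b where "a = infnorm \<mu>bar + trace Ybar" "b = infnorm \<mu>hat + trace Yhat"
  have ab: "0 \<le> a" "0 \<le> b" using assms infnorm_pos_le by (auto simp: a_b_def intro: add_nonneg_nonneg)
  have "0 < a + b" if "\<rho> * a > 1 \<or> \<rho> * b > 1"
    using that ab by (cases "a = 0"; cases "b = 0") auto
  moreover have "\<delta> * \<rho> \<le> \<rho>" using assms by simp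
  moreover have "infnorm \<mu>bar + trace Ybar + infnorm \<mu>hat + trace Yhat = a + b"
    by (simp add: a_b_def)
  ultimately show "0 < penalty_multiplier_update \<epsilon> \<delta> \<rho> \<mu>bar Ybar \<mu>hat Yhat"
    "penalty_multiplier_update \<epsilon> \<delta> \<rho> \<mu>bar Ybar \<mu>hat Yhat \<le> \<rho>"
    using assms unfolding penalty_multiplier_update_def a_b_def[symmetric]
    by (auto simp: min_le_iff_disj)
qed

text \<open>The update is triggered only if \<open>(1 - \<epsilon>) * v < \<rho>' * g\<close>, where \<open>v\<close> is the decrease of the linearized violation and
  \<open>g\<close> the slope of \<open>f\<close>. Then \<open>g > 0\<close>, so the denominator is positive and dominates \<open>g\<close>, and the new parameter
  satisfies \<open>\<rho>'' * g \<le> (1 - \<epsilon>) * v\<close>. The last assumption excludes \<open>v = 0\<close> in this case, where the parameter would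
  become zero.\<close>

lemma penalty_decrease_update_props:
  assumes upd: "\<rho>'' = penalty_decrease_update f h G \<epsilon> \<delta> B x d \<rho>'"
    and params: "0 < \<epsilon>" "\<epsilon> < 1" "0 < \<delta>" "\<delta> < 1" and pos: "0 < \<rho>'"
    and V: "0 \<le> delta_lin_violation h G x d" and B: "0 \<le> d \<bullet> (B *v d)"
    and descent: "delta_lin_violation h G x d = 0 \<Longrightarrow> gradient f x \<bullet> d \<le> 0"
  shows "0 < \<rho>''" "\<rho>'' \<le> \<rho>'"
    "\<epsilon> * delta_lin_violation h G x d \<le> delta_lin_penalty f h G \<rho>'' x d"
proof -
  define v g where "v = delta_lin_violation h G x d" "g = gradient f x \<bullet> d"
  have pen: "delta_lin_penalty f h G p x d = - p * g + v" for p
    by (simp add: delta_lin_penalty_def v_g_def)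
  have "0 < \<rho>'' \<and> \<rho>'' \<le> \<rho>' \<and> \<epsilon> * v \<le> - \<rho>'' * g + v"
  proof (cases "- \<rho>' * g + v < \<epsilon> * v")
    case False
    then have "\<rho>'' = \<rho>'" by (simp add: upd penalty_decrease_update_def pen flip: v_g_def)
    then show ?thesis using False pos by simp
  next
    case True
    then have gpos: "(1 - \<epsilon>) * v < \<rho>' * g" by (simp add: algebra_simps)
    have "0 \<le> (1 - \<epsilon>) * v" using params V by (simp add: v_g_def)
    then have g: "0 < g" using gpos pos by (meson le_less_trans zero_less_mult_pos)
    then have v: "0 < v" using V descent by (force simp: v_g_def)
    define q where "q = g + 1/2 * (d \<bullet> (B *v d))"
    have q: "0 < q" "g \<le> q" using g B by (auto simp: q_def)
    have \<rho>'': "\<rho>'' = min (\<delta> * \<rho>') ((1 - \<epsilon>) * v / q)"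
      using True by (simp add: upd penalty_decrease_update_def pen q_def flip: v_g_def)
    have pos'': "0 < \<rho>''" using \<rho>'' params pos v q by simp
    moreover have "\<delta> * \<rho>' \<le> \<rho>'" using params pos by simp
    then have "\<rho>'' \<le> \<rho>'" unfolding \<rho>'' by linarith
    moreover have "\<rho>'' * g \<le> (1 - \<epsilon>) * v"
    proof -
      have "\<rho>'' * g \<le> \<rho>'' * q" using pos'' q by simp
      also have "\<dots> \<le> (1 - \<epsilon>) * v / q * q"
        unfolding \<rho>'' using q by (intro mult_right_mono) auto
      finally show ?thesis using q by simp
    qed
    ultimately show ?thesis by (simp add: algebra_simps)
  qed
  then show "0 < \<rho>''" "\<rho>'' \<le> \<rho>'" "\<epsilon> * delta_lin_violation h G x d \<le> delta_lin_penalty f h G \<rho>'' x d"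
    by (simp_all add: pen flip: v_g_def)
qed

text \<open>Either the full step is accepted, or \<open>\<alpha> / \<gamma>\<close> was rejected, and then the quadratic upper model forces
  \<open>(1 - \<eta>) * \<Delta> < C * (\<alpha> / \<gamma>)\<close> for the predicted decrease \<open>\<Delta>\<close>.\<close>

lemma line_search_step_ge:
  assumes ls: "line_search f h G \<eta> \<gamma> \<rho> x d \<alpha>" and \<gamma>: "0 < \<gamma>" "\<gamma> < 1" and C: "0 < C"
    and model: "\<And>u. 0 \<le> u \<Longrightarrow> u \<le> 1 \<Longrightarrow>
      penalty f h G \<rho> (x + u *\<^sub>R d) - penalty f h G \<rho> x \<le> - u * delta_lin_penalty f h G \<rho> x d + C * u\<^sup>2"
  shows "min 1 (\<gamma> * (1 - \<eta>) / C * delta_lin_penalty f h G \<rho> x d) \<le> \<alpha>"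
proof -
  define D where "D = delta_lin_penalty f h G \<rho> x d"
  obtain j where j: "\<alpha> = \<gamma> ^ j" "\<And>i. i < j \<Longrightarrow> \<not> sufficient_decrease f h G \<eta> \<rho> x d (\<gamma> ^ i)"
    using ls unfolding line_search_def by blast
  show ?thesis
  proof (cases j)
    case 0
    then show ?thesis using j(1) by simp
  next
    case (Suc i)
    define u where "u = \<gamma> ^ i"
    have u: "0 < u" "u \<le> 1" using \<gamma> by (simp_all add: u_def power_le_one)
    have "\<not> sufficient_decrease f h G \<eta> \<rho> x d u"
      using j(2)[of i] Suc by (simp add: u_def)
    then have "- \<eta> * u * D < - u * D + C * u\<^sup>2"
      using model[of u] u unfolding sufficient_decrease_def D_def[symmetric] by linarith
    then have "u * ((1 - \<eta>) * D) < u * (C * u)"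
      by (simp add: algebra_simps power2_eq_square)
    then have "(1 - \<eta>) * D < C * u" using u by simp
    then have "(1 - \<eta>) * D / C \<le> u" using C by (simp add: divide_le_eq mult.commute)
    then have "\<gamma> * ((1 - \<eta>) * D / C) \<le> \<gamma> * u" using \<gamma> by (intro mult_left_mono) auto
    then show ?thesis using j(1) Suc by (simp add: D_def[symmetric] u_def mult_ac min_le_iff_disj)
  qed
qed

lemma quadratic_inequality_bound:
  fixes a b c q :: real
  assumes "0 < a" "0 \<le> c" "0 \<le> q" "a * q\<^sup>2 \<le> b * q + c"
  shows "q \<le> max 1 ((b + c) / a)"
proof (cases "q \<le> 1")
  case False
  have "c * 1 \<le> c * q" using assms(2) False by (intro mult_left_mono) auto
  then have "q * (a * q) \<le> q * (b + c)"
    using assms(4) by (simp add: power2_eq_square algebra_simps)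
  then have "a * q \<le> b + c" using False by simp
  then have "q \<le> (b + c) / a" using assms(1) by (simp add: le_divide_eq mult.commute)
  then show ?thesis by simp
qed simp

text \<open>The product on the left is \<open>a\<close> or \<open>c * a\<^sup>2\<close>; the bound tends to zero with \<open>y\<close> and covers both cases.\<close>

lemma backtracking_decrease_inverse:
  fixes a c y :: real
  assumes "0 \<le> a" "0 < c" "min 1 (c * a) * a \<le> y"
  shows "a \<le> y + sqrt (y / c)"
proof (cases "c * a \<le> 1")
  case True
  then have "c * a\<^sup>2 \<le> y" using assms(3) by (simp add: min_def power2_eq_square mult_ac split: if_splits)
  then have "a\<^sup>2 \<le> y / c" using assms(2) by (simp add: le_divide_eq mult.commute)
  then have "a \<le> sqrt (y / c)" by (rule real_le_rsqrt)
  moreover have "0 \<le> y" using \<open>c * a\<^sup>2 \<le> y\<close> assms(2) by (meson less_imp_le mult_nonneg_nonneg order_trans zero_le_power2)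
  ultimately show ?thesis by simp
next
  case False
  then have "a \<le> y" using assms(3) by (simp add: min_def)
  then have "0 \<le> sqrt (y / c)" using assms by simp
  then show ?thesis using \<open>a \<le> y\<close> by linarith
qed

section \<open>Convergence of the algorithm\<close>

locale sqp_run =
  fixes f :: "real ^ 'n \<Rightarrow> real"
    and h :: "real ^ 'n \<Rightarrow> real ^ 'l"
    and G :: "real ^ 'n \<Rightarrow> real ^ 'm ^ 'm"
    and \<epsilon> \<delta> \<eta> \<gamma> b1 b2 :: real
    and x dfea d :: "nat \<Rightarrow> real ^ 'n"
    and r s :: "nat \<Rightarrow> real ^ 'l"
    and t \<rho> \<rho>' \<alpha> :: "nat \<Rightarrow> real"
    and Bfea B :: "nat \<Rightarrow> real ^ 'n ^ 'n"
    and \<mu>bar \<mu>hat :: "nat \<Rightarrow> real ^ 'l"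
    and Ybar Yhat :: "nat \<Rightarrow> real ^ 'm ^ 'm"
    and \<Omega> :: "(real ^ 'n) set"
  assumes G_sym: "sym_matrix (G z)"
    and params: "0 < \<epsilon>" "\<epsilon> < 1" "0 < \<delta>" "\<delta> < 1" "0 < \<eta>" "\<eta> < 1" "0 < \<gamma>" "\<gamma> < 1"
    and rho0: "0 < \<rho> 0"
    and pd: "pos_def (Bfea k)"
    and step1: "feas_step h G (Bfea k) (x k) (dfea k) (r k) (s k) (t k) (\<mu>bar (Suc k)) (Ybar (Suc k))"
    and step2: "opt_step f h G (B k) (\<rho> k) (x k) (r k) (s k) (t k) (d k) (\<mu>hat (Suc k)) (Yhat (Suc k))"
    and step4a: "\<rho>' k = penalty_multiplier_update \<epsilon> \<delta> (\<rho> k)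
                   (\<mu>bar (Suc k)) (Ybar (Suc k)) (\<mu>hat (Suc k)) (Yhat (Suc k))"
    and step4b: "\<rho> (Suc k) = penalty_decrease_update f h G \<epsilon> \<delta> (B k) (x k) (d k) (\<rho>' k)"
    and step5a: "line_search f h G \<eta> \<gamma> (\<rho> (Suc k)) (x k) (d k) (\<alpha> k)"
    and step5b: "x (Suc k) = x k + \<alpha> k *\<^sub>R d k"
    and smooth: "twice_cont_diff f" "twice_cont_diff h" "twice_cont_diff G"
    and compact: "compact \<Omega>" and iterates: "x k \<in> \<Omega>"
    and b1: "0 < b1"
    and Bfea_bounds: "b1 * (norm z)\<^sup>2 \<le> z \<bullet> (Bfea k *v z)" "z \<bullet> (Bfea k *v z) \<le> b2 * (norm z)\<^sup>2"
    and B_bounds: "b1 * (norm z)\<^sup>2 \<le> z \<bullet> (B k *v z)" "z \<bullet> (B k *v z) \<le> b2 * (norm z)\<^sup>2"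
begin

lemma b2_nonneg: "0 \<le> b2"
proof -
  have "b1 * (norm (axis undefined 1 :: real ^ 'n))\<^sup>2 \<le> b2 * (norm (axis undefined 1 :: real ^ 'n))\<^sup>2"
    using B_bounds order_trans by blast
  then show ?thesis using b1 by simp
qed

lemma feas_argmin:
  "is_arg_min (feas_objective (Bfea k)) (feas_constraints h G (x k)) (dfea k, r k, s k, t k)"
  using step1[of k] by (simp add: feas_step_def)

lemma opt_feasible: "opt_constraints h G (x k) (r k) (s k) (t k) (d k)"
  using step2[of k] by (simp add: opt_step_def is_arg_min_def)

lemma opt_objective_le:
  "opt_objective f (B k) (\<rho> k) (x k) (d k) \<le> opt_objective f (B k) (\<rho> k) (x k) (dfea k)"
proof -
  have "opt_constraints h G (x k) (r k) (s k) (t k) (dfea k)"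
    using feas_argmin[of k] by (simp add: is_arg_min_def feas_constraints_def opt_constraints_def)
  then show ?thesis
    using step2[of k] by (simp add: opt_step_def is_arg_min_linorder)
qed

lemma sym_DG: "sym_matrix (DG G (x k) (d k))"
proof -
  have "sym_matrix (G (x k) + DG G (x k) (d k))"
    using opt_feasible[of k] by (simp add: opt_constraints_def loewner_le_scaled_identity_iff)
  then show ?thesis using sym_matrix_diff[OF _ G_sym[of "x k"]] by fastforce
qed

lemma feas_step_le_violation: "b1 / 2 * (norm (dfea k))\<^sup>2 \<le> violation h G (x k)"
  using feas_step_decrease[OF feas_argmin[of k] G_sym] Bfea_bounds(1)[of "dfea k" k]
    lin_violation_nonneg[of h G "x k" "dfea k"]
  by (simp add: delta_lin_violation_def lin_violation_zero)

lemma violation_decrease_ge: "b1 / 2 * (norm (dfea k))\<^sup>2 \<le> delta_lin_violation h G (x k) (d k)"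
  using feas_step_decrease[OF feas_argmin[of k] G_sym] Bfea_bounds(1)[of "dfea k" k]
    opt_constraints_lin_violation_le[OF feas_argmin opt_feasible, of k]
  by (simp add: delta_lin_violation_def)

lemma violation_decrease_nonneg: "0 \<le> delta_lin_violation h G (x k) (d k)"
  using violation_decrease_ge[of k] b1 by (meson divide_nonneg_pos less_imp_le mult_nonneg_nonneg order_trans zero_le_power2 zero_less_numeral)

lemma penalty_parameter_step:
  assumes "0 < \<rho> k"
  shows "0 < \<rho> (Suc k)" "\<rho> (Suc k) \<le> \<rho> k"
    "\<epsilon> * delta_lin_violation h G (x k) (d k) \<le> delta_lin_penalty f h G (\<rho> (Suc k)) (x k) (d k)"
proof -
  have tr: "0 \<le> trace Y" if "pos_semidef Y" for Y :: "real ^ 'm ^ 'm"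
    using pos_semidef_norm_le_trace[OF that] norm_ge_zero order_trans by blast
  have "pos_semidef (Ybar (Suc k))" "pos_semidef (Yhat (Suc k))"
    using step1[of k] step2[of k] by (simp_all add: feas_step_def feas_multipliers_def opt_step_def opt_multipliers_def)
  note tr = this[THEN tr]
  have \<rho>': "0 < \<rho>' k" "\<rho>' k \<le> \<rho> k"
    unfolding step4a using params assms tr by (intro penalty_multiplier_update_pos; simp)+
  have dBd: "0 \<le> d k \<bullet> (B k *v d k)"
    using B_bounds(1)[of "d k" k] b1 by (meson less_imp_le mult_nonneg_nonneg order_trans zero_le_power2)
  have descent: "gradient f (x k) \<bullet> d k \<le> 0" if "delta_lin_violation h G (x k) (d k) = 0"
  proof -
    \<comment> \<open>then the zero step is feasible for the second subproblem\<close>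
    have "dfea k = 0"
      using violation_decrease_ge[of k] that b1 by (simp add: mult_le_0_iff)
    then have "\<rho> k * (gradient f (x k) \<bullet> d k) \<le> 0"
      using opt_objective_le[of k] dBd by (simp add: opt_objective_def)
    then show ?thesis using assms by (simp add: mult_le_0_iff)
  qed
  note upd = penalty_decrease_update_props[OF step4b params(1-4) \<rho>'(1) violation_decrease_nonneg dBd descent]
  show "0 < \<rho> (Suc k)" "\<rho> (Suc k) \<le> \<rho> k"
    "\<epsilon> * delta_lin_violation h G (x k) (d k) \<le> delta_lin_penalty f h G (\<rho> (Suc k)) (x k) (d k)"
    using upd \<rho>'(2) by auto
qed

lemma rho_pos: "0 < \<rho> k"
  by (induction k) (use rho0 penalty_parameter_step in auto)

lemma rho_le: "\<rho> k \<le> \<rho> 0"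
proof (induction k)
  case (Suc k)
  then show ?case using penalty_parameter_step(2)[OF rho_pos, of k] by simp
qed simp

lemma model_decrease_nonneg: "0 \<le> delta_lin_penalty f h G (\<rho> (Suc k)) (x k) (d k)"
  using penalty_parameter_step(3)[OF rho_pos, of k] violation_decrease_nonneg[of k] params(1)
  by (meson less_imp_le mult_nonneg_nonneg order_trans)

text \<open>Compare with \<open>dfea k\<close>, which is feasible for the second subproblem and bounded because the violation is bounded
  on \<open>\<Omega>\<close>: the quadratic term of the objective dominates the linear one, whose coefficient is bounded since \<open>\<rho>\<close>
  is nonincreasing.\<close>

lemma steps_bounded:
  obtains D where "0 \<le> D" "\<And>k. norm (d k) \<le> D"
proof -
  have "bounded (h ` \<Omega>)" "bounded (G ` \<Omega>)"
    by (intro compact_imp_bounded compact_continuous_image twice_cont_diff_continuous_on smooth compact)+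
  then obtain Mh MG where M: "0 < Mh" "\<And>z. z \<in> \<Omega> \<Longrightarrow> norm (h z) \<le> Mh"
     "0 < MG" "\<And>z. z \<in> \<Omega> \<Longrightarrow> norm (G z) \<le> MG"
    unfolding bounded_pos by auto
  define V where "V = real CARD('l) * Mh + MG"
  have "0 \<le> V" using M by (simp add: V_def)
  have V: "violation h G (x k) \<le> V" for k
    unfolding V_def using M iterates
    by (intro order_trans[OF violation_le_norms[OF G_sym]] add_mono mult_left_mono) auto
  \<comment> \<open>the bound of \<open>quadratic_inequality_bound\<close> without a linear term\<close>
  define E where "E = max 1 ((0 + V) / (b1 / 2))"
  have E: "norm (dfea k) \<le> E" for k
    unfolding E_def using b1 \<open>0 \<le> V\<close> feas_step_le_violation[of k] V[of k]
    by (intro quadratic_inequality_bound) auto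
  obtain Mf where Mf: "0 \<le> Mf" "\<And>z v. z \<in> \<Omega> \<Longrightarrow> norm (frechet_derivative f (at z) v) \<le> Mf * norm v"
    using frechet_derivative_bounded_on_compact[OF smooth(1) compact] by blast
  have g: "\<bar>\<rho> k * (gradient f (x k) \<bullet> v)\<bar> \<le> \<rho> 0 * Mf * norm v" for k v
  proof -
    have "\<bar>\<rho> k * (gradient f (x k) \<bullet> v)\<bar> = \<rho> k * \<bar>gradient f (x k) \<bullet> v\<bar>"
      using rho_pos[of k] by (simp add: abs_mult)
    also have "\<dots> \<le> \<rho> 0 * (Mf * norm v)"
      using rho_le[of k] rho0 Mf(2)[OF iterates, of k v]
      by (intro mult_mono) (auto simp: gradient_inner[OF twice_cont_diff_differentiable[OF smooth(1)]])
    finally show ?thesis by simp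
  qed
  define c where "c = \<rho> 0 * Mf * E + b2 / 2 * E\<^sup>2"
  have "0 \<le> E" by (simp add: E_def)
  then have "0 \<le> c" using rho0 Mf(1) b2_nonneg by (simp add: c_def)
  have "norm (d k) \<le> max 1 ((\<rho> 0 * Mf + c) / (b1 / 2))" for k
  proof (rule quadratic_inequality_bound)
    have "b1 / 2 * (norm (d k))\<^sup>2 \<le> 1/2 * (d k \<bullet> (B k *v d k))"
      using B_bounds(1)[of "d k" k] by simp
    also have "\<dots> \<le> \<rho> k * (gradient f (x k) \<bullet> dfea k) + 1/2 * (dfea k \<bullet> (B k *v dfea k))
        - \<rho> k * (gradient f (x k) \<bullet> d k)"
      using opt_objective_le[of k] by (simp add: opt_objective_def)
    also have "\<dots> \<le> \<rho> 0 * Mf * norm (dfea k) + b2 / 2 * (norm (dfea k))\<^sup>2 + \<rho> 0 * Mf * norm (d k)"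
      using g[of k "dfea k"] g[of k "d k"] B_bounds(2)[of "dfea k" k] by (simp add: abs_le_iff)
    also have "\<dots> \<le> \<rho> 0 * Mf * E + b2 / 2 * E\<^sup>2 + \<rho> 0 * Mf * norm (d k)"
      using E[of k] rho0 Mf(1) b2_nonneg by (intro add_mono mult_left_mono power_mono) auto
    finally show "b1 / 2 * (norm (d k))\<^sup>2 \<le> \<rho> 0 * Mf * norm (d k) + c"
      by (simp add: c_def)
  qed (use b1 \<open>0 \<le> c\<close> in auto)
  then show ?thesis by (intro that[of "max 1 ((\<rho> 0 * Mf + c) / (b1 / 2))"]) auto
qed

text \<open>Trial points need not lie in \<open>\<Omega>\<close>, but they stay in a ball that exceeds \<open>\<Omega>\<close> by the bound on the steps, and the
  remainder estimates are uniform on that ball.\<close>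

lemma step_length_ge:
  obtains c where "0 < c"
    "\<And>k. min 1 (c * delta_lin_penalty f h G (\<rho> (Suc k)) (x k) (d k)) \<le> \<alpha> k"
proof -
  obtain D where D: "0 \<le> D" "\<And>k. norm (d k) \<le> D" using steps_bounded by blast
  obtain R0 where R0: "\<And>z. z \<in> \<Omega> \<Longrightarrow> norm z \<le> R0"
    using compact_imp_bounded[OF compact] unfolding bounded_iff by blast
  define R where "R = R0 + D"
  obtain Lf where Lf: "0 \<le> Lf" "\<And>z v. z \<in> cball 0 R \<Longrightarrow> z + v \<in> cball 0 R \<Longrightarrow>
      norm (f (z + v) - f z - frechet_derivative f (at z) v) \<le> Lf * (norm v)\<^sup>2"
    using taylor_first_order_on_ball[OF smooth(1)] by blast
  obtain Lv where Lv: "0 \<le> Lv" "\<And>z v u. z \<in> cball 0 R \<Longrightarrow> z + u *\<^sub>R v \<in> cball 0 R \<Longrightarrow> 0 \<le> u \<Longrightarrow> u \<le> 1 \<Longrightarrow>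
      sym_matrix (DG G z v) \<Longrightarrow>
      violation h G (z + u *\<^sub>R v) \<le> violation h G z - u * delta_lin_violation h G z v + Lv * (norm (u *\<^sub>R v))\<^sup>2"
    using violation_descent[OF smooth(2,3) G_sym] by blast
  \<comment> \<open>the summand 1 only makes \<open>C\<close> positive\<close>
  define C where "C = (\<rho> 0 * Lf + Lv) * D\<^sup>2 + 1"
  have "0 \<le> (\<rho> 0 * Lf + Lv) * D\<^sup>2" using Lf(1) Lv(1) rho0 by simp
  then have C: "0 < C" by (simp add: C_def)
  have model: "penalty f h G (\<rho> (Suc k)) (x k + u *\<^sub>R d k) - penalty f h G (\<rho> (Suc k)) (x k)
      \<le> - u * delta_lin_penalty f h G (\<rho> (Suc k)) (x k) (d k) + C * u\<^sup>2" if u: "0 \<le> u" "u \<le> 1" for k u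
  proof -
    have nu: "norm (u *\<^sub>R d k) \<le> u * D" using u D(2)[of k] by (simp add: mult_left_mono)
    also have "u * D \<le> 1 * D" using u D(1) by (intro mult_right_mono)
    finally have ball: "x k \<in> cball 0 R" "x k + u *\<^sub>R d k \<in> cball 0 R"
      using R0[OF iterates[of k]] D(1) norm_triangle_ineq[of "x k" "u *\<^sub>R d k"] by (auto simp: R_def)
    have nu2: "(norm (u *\<^sub>R d k))\<^sup>2 \<le> u\<^sup>2 * D\<^sup>2"
      using power_mono[OF nu norm_ge_zero, of 2] by (simp add: power_mult_distrib)
    have "f (x k + u *\<^sub>R d k) - f (x k) - gradient f (x k) \<bullet> (u *\<^sub>R d k) \<le> Lf * (norm (u *\<^sub>R d k))\<^sup>2"
      using Lf(2)[OF ball] gradient_inner[OF twice_cont_diff_differentiable[OF smooth(1)], of "x k" "u *\<^sub>R d k"]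
      by (simp only: real_norm_def abs_le_iff)
    then have "\<rho> (Suc k) * (f (x k + u *\<^sub>R d k) - f (x k) - u * (gradient f (x k) \<bullet> d k))
        \<le> \<rho> 0 * (Lf * (norm (u *\<^sub>R d k))\<^sup>2)"
      using rho_pos[of "Suc k"] rho_le[of "Suc k"] Lf(1)
      by (intro order_trans[OF mult_left_mono mult_right_mono]) auto
    moreover have "violation h G (x k + u *\<^sub>R d k)
        \<le> violation h G (x k) - u * delta_lin_violation h G (x k) (d k) + Lv * (norm (u *\<^sub>R d k))\<^sup>2"
      by (rule Lv(2)[OF ball u sym_DG])
    moreover have "(\<rho> 0 * Lf + Lv) * (norm (u *\<^sub>R d k))\<^sup>2 \<le> C * u\<^sup>2"
    proof -
      have "(\<rho> 0 * Lf + Lv) * (norm (u *\<^sub>R d k))\<^sup>2 \<le> (\<rho> 0 * Lf + Lv) * (u\<^sup>2 * D\<^sup>2)"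
        using nu2 Lf(1) Lv(1) rho0 by (intro mult_left_mono) auto
      also have "\<dots> \<le> C * u\<^sup>2" by (simp add: C_def algebra_simps)
      finally show ?thesis .
    qed
    ultimately show ?thesis
      unfolding penalty_def delta_lin_penalty_def by (simp add: algebra_simps)
  qed
  show ?thesis
  proof (rule that)
    show "0 < \<gamma> * (1 - \<eta>) / C" using C params by simp
    show "min 1 (\<gamma> * (1 - \<eta>) / C * delta_lin_penalty f h G (\<rho> (Suc k)) (x k) (d k)) \<le> \<alpha> k" for k
      by (rule line_search_step_ge[OF step5a params(7,8) C model])
  qed
qed

text \<open>The merit function \<open>\<phi>\<close> below decreases and is bounded below, hence its consecutive differences tend to zero. They
  dominate \<open>\<eta> * \<alpha> k * \<Delta> k\<close>, and \<open>\<alpha> k\<close> is bounded below in terms of \<open>\<Delta> k\<close> itself.\<close>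

lemma model_decrease_tendsto_zero:
  "(\<lambda>k. delta_lin_penalty f h G (\<rho> (Suc k)) (x k) (d k)) \<longlonglongrightarrow> 0"
proof -
  define \<Delta> where "\<Delta> k = delta_lin_penalty f h G (\<rho> (Suc k)) (x k) (d k)" for k
  have \<Delta>: "0 \<le> \<Delta> k" for k unfolding \<Delta>_def by (rule model_decrease_nonneg)
  obtain c where c: "0 < c" "\<And>k. min 1 (c * \<Delta> k) \<le> \<alpha> k"
    unfolding \<Delta>_def using step_length_ge by blast
  have "bounded (f ` \<Omega>)"
    by (intro compact_imp_bounded compact_continuous_image twice_cont_diff_continuous_on smooth compact)
  then obtain M where M: "\<And>z. z \<in> \<Omega> \<Longrightarrow> \<bar>f z\<bar> \<le> M"
    unfolding bounded_iff by auto
  define \<phi> where "\<phi> k = \<rho> k * (f (x k) + M) + violation h G (x k)" for k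
  have fM: "0 \<le> f (x k) + M" for k using M[OF iterates, of k] by linarith
  have \<phi>0: "0 \<le> \<phi> k" for k
    unfolding \<phi>_def
    by (rule add_nonneg_nonneg[OF mult_nonneg_nonneg[OF less_imp_le[OF rho_pos] fM] violation_nonneg])
  have dec: "\<eta> * (\<alpha> k * \<Delta> k) \<le> \<phi> k - \<phi> (Suc k)" for k
  proof -
    have "sufficient_decrease f h G \<eta> (\<rho> (Suc k)) (x k) (d k) (\<alpha> k)"
      using step5a[of k] unfolding line_search_def by auto
    then have "penalty f h G (\<rho> (Suc k)) (x (Suc k)) - penalty f h G (\<rho> (Suc k)) (x k) \<le> - \<eta> * \<alpha> k * \<Delta> k"
      by (simp add: sufficient_decrease_def step5b \<Delta>_def)
    moreover have "\<rho> (Suc k) * (f (x k) + M) \<le> \<rho> k * (f (x k) + M)"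
      using penalty_parameter_step(2)[OF rho_pos, of k] fM by (intro mult_right_mono) auto
    ultimately show ?thesis
      unfolding \<phi>_def penalty_def by (simp add: algebra_simps)
  qed
  have gain: "0 \<le> min 1 (c * \<Delta> k) * \<Delta> k" "min 1 (c * \<Delta> k) * \<Delta> k \<le> (\<phi> k - \<phi> (Suc k)) / \<eta>" for k
  proof -
    show "0 \<le> min 1 (c * \<Delta> k) * \<Delta> k" using \<Delta>[of k] c(1) by (intro mult_nonneg_nonneg) auto
    have "min 1 (c * \<Delta> k) * \<Delta> k \<le> \<alpha> k * \<Delta> k" by (intro mult_right_mono c \<Delta>)
    also have "\<dots> \<le> (\<phi> k - \<phi> (Suc k)) / \<eta>"
      using dec[of k] params(5) by (simp add: le_divide_eq mult.commute)
    finally show "min 1 (c * \<Delta> k) * \<Delta> k \<le> (\<phi> k - \<phi> (Suc k)) / \<eta>" .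
  qed
  have "decseq \<phi>"
  proof (rule decseq_SucI)
    fix k
    have "0 \<le> (\<phi> k - \<phi> (Suc k)) / \<eta>" using gain[of k] by linarith
    then show "\<phi> (Suc k) \<le> \<phi> k" using params(5) by (simp add: zero_le_divide_iff)
  qed
  then obtain l where l: "\<phi> \<longlonglongrightarrow> l" using decseq_convergent[of \<phi> 0] \<phi>0 by blast
  have "(\<lambda>k. (\<phi> k - \<phi> (Suc k)) / \<eta>) \<longlonglongrightarrow> (l - l) / \<eta>"
    by (intro tendsto_divide tendsto_diff l LIMSEQ_Suc[OF l] tendsto_const) (use params in simp)
  then have y: "(\<lambda>k. (\<phi> k - \<phi> (Suc k)) / \<eta>) \<longlonglongrightarrow> 0" by simp
  have "(\<lambda>k. (\<phi> k - \<phi> (Suc k)) / \<eta> + sqrt ((\<phi> k - \<phi> (Suc k)) / \<eta> / c)) \<longlonglongrightarrow> 0 + sqrt (0 / c)"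
    by (intro tendsto_add tendsto_real_sqrt tendsto_divide y tendsto_const) (use c in simp)
  then have bound: "(\<lambda>k. (\<phi> k - \<phi> (Suc k)) / \<eta> + sqrt ((\<phi> k - \<phi> (Suc k)) / \<eta> / c)) \<longlonglongrightarrow> 0" by simp
  have "\<Delta> \<longlonglongrightarrow> 0"
  proof (rule tendsto_sandwich[OF _ _ tendsto_const bound])
    show "\<forall>\<^sub>F k in sequentially. 0 \<le> \<Delta> k" using \<Delta> by simp
    show "\<forall>\<^sub>F k in sequentially. \<Delta> k \<le> (\<phi> k - \<phi> (Suc k)) / \<eta> + sqrt ((\<phi> k - \<phi> (Suc k)) / \<eta> / c)"
      by (intro always_eventually allI backtracking_decrease_inverse \<Delta> c(1) gain(2))
  qed
  then show ?thesis by (simp add: \<Delta>_def[abs_def])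
qed

lemma feas_steps_tendsto_zero: "(\<lambda>k. norm (dfea k)) \<longlonglongrightarrow> 0"
proof -
  let ?\<Delta> = "\<lambda>k. delta_lin_penalty f h G (\<rho> (Suc k)) (x k) (d k)"
  have "(\<lambda>k. sqrt (2 / (b1 * \<epsilon>) * ?\<Delta> k)) \<longlonglongrightarrow> sqrt (2 / (b1 * \<epsilon>) * 0)"
    by (intro tendsto_real_sqrt tendsto_mult tendsto_const model_decrease_tendsto_zero)
  then have lim: "(\<lambda>k. sqrt (2 / (b1 * \<epsilon>) * ?\<Delta> k)) \<longlonglongrightarrow> 0" by simp
  have "norm (dfea k) \<le> sqrt (2 / (b1 * \<epsilon>) * ?\<Delta> k)" for k
  proof (rule real_le_rsqrt)
    have "\<epsilon> * (b1 / 2 * (norm (dfea k))\<^sup>2) \<le> ?\<Delta> k"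
      using penalty_parameter_step(3)[OF rho_pos, of k] violation_decrease_ge[of k] params(1)
      by (meson less_imp_le mult_left_mono order_trans)
    then show "(norm (dfea k))\<^sup>2 \<le> 2 / (b1 * \<epsilon>) * ?\<Delta> k"
      using b1 params(1) by (simp add: field_simps)
  qed
  then show ?thesis
    by (intro tendsto_sandwich[OF _ _ tendsto_const lim]) simp_all
qed

lemma residual_tendsto_zero:
  "(\<lambda>k. feas_residual f h G (x k) (\<mu>bar (Suc k)) (Ybar (Suc k))) \<longlonglongrightarrow> 0"
proof -
  obtain Mh where "0 \<le> Mh" and Mh: "\<And>z v. z \<in> \<Omega> \<Longrightarrow> norm (frechet_derivative h (at z) v) \<le> Mh * norm v"
    using frechet_derivative_bounded_on_compact[OF smooth(2) compact] by blast
  obtain MG where "0 \<le> MG" and MG: "\<And>z v. z \<in> \<Omega> \<Longrightarrow> norm (frechet_derivative G (at z) v) \<le> MG * norm v"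
    using frechet_derivative_bounded_on_compact[OF smooth(3) compact] by blast
  note diff = smooth[THEN twice_cont_diff_differentiable]
  define C where "C = b2 + 4 * Mh + (2 + norm (mat 1 :: real ^ 'm ^ 'm)) * MG"
  have le: "feas_residual f h G (x k) (\<mu>bar (Suc k)) (Ybar (Suc k)) \<le> C * norm (dfea k)" for k
    unfolding C_def
  proof (rule feas_residual_le_step[OF step1 _ diff(2,3) G_sym])
    show sym: "sym_matrix (Bfea k)" using pd by (simp add: pos_def_def)
    have "0 \<le> z \<bullet> (Bfea k *v z)" for z
      using Bfea_bounds(1)[of z k] b1 by (meson less_imp_le mult_nonneg_nonneg order_trans zero_le_power2)
    then have "pos_semidef (Bfea k)" using sym by (simp add: pos_semidef_def)
    then show "norm (Bfea k *v dfea k) \<le> b2 * norm (dfea k)"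
      by (rule pos_semidef_norm_le[OF _ Bfea_bounds(2) b2_nonneg])
    show "norm (Jac h (x k) *v dfea k) \<le> Mh * norm (dfea k)"
      unfolding Jac_mult[OF diff(2)] by (rule Mh[OF iterates])
    show "norm (DG G (x k) (dfea k)) \<le> MG * norm (dfea k)"
      unfolding DG_frechet[OF diff(3)] by (rule MG[OF iterates])
  qed
  have "(\<lambda>k. C * norm (dfea k)) \<longlonglongrightarrow> C * 0"
    by (intro tendsto_mult tendsto_const feas_steps_tendsto_zero)
  then have "(\<lambda>k. C * norm (dfea k)) \<longlonglongrightarrow> 0" by simp
  then show ?thesis
    by (rule tendsto_sandwich[OF _ _ tendsto_const, rotated 2]) (simp_all add: feas_residual_nonneg le)
qed

text \<open>The residual is continuous in the point and the multipliers, so it vanishes at the limit.\<close>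

lemma limit_point_first_order:
  assumes "strict_mono \<sigma>"
    and lim: "(\<lambda>k. (x (\<sigma> k), \<mu>bar (Suc (\<sigma> k)), Ybar (Suc (\<sigma> k)))) \<longlonglongrightarrow> (x', \<mu>, Y)"
  shows "violation_first_order h G x' \<mu> Y"
proof -
  have X: "(\<lambda>k. x (\<sigma> k)) \<longlonglongrightarrow> x'" and M: "(\<lambda>k. \<mu>bar (Suc (\<sigma> k))) \<longlonglongrightarrow> \<mu>"
    and Z: "(\<lambda>k. Ybar (Suc (\<sigma> k))) \<longlonglongrightarrow> Y"
    using tendsto_fst[OF lim] tendsto_fst[OF tendsto_snd[OF lim]] tendsto_snd[OF tendsto_snd[OF lim]] by simp_all
  have kkt: "pos_semidef (Ybar (Suc k))" "- 1 \<le> \<mu>bar (Suc k)" "\<mu>bar (Suc k) \<le> 1" "trace (Ybar (Suc k)) \<le> 1" for k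
    using feas_step_kkt(1-4)[OF step1[of k]] pd[of k] by (simp_all add: pos_def_def)
  have "(\<lambda>k. feas_residual f h G (x (\<sigma> k)) (\<mu>bar (Suc (\<sigma> k))) (Ybar (Suc (\<sigma> k)))) \<longlonglongrightarrow> 0"
    using LIMSEQ_subseq_LIMSEQ[OF residual_tendsto_zero assms(1)] by (simp add: o_def)
  then have zero: "feas_residual f h G x' \<mu> Y = 0"
    using tendsto_feas_residual[OF smooth(2,3) G_sym X M Z] LIMSEQ_unique by blast
  have comp: "(\<lambda>k. \<mu>bar (Suc (\<sigma> k)) $ i) \<longlonglongrightarrow> \<mu> $ i" for i by (intro tendsto_vec_nth M)
  have tr: "(\<lambda>k. trace (Ybar (Suc (\<sigma> k)))) \<longlonglongrightarrow> trace Y"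
    unfolding trace_def by (intro tendsto_intros Z)
  show ?thesis
  proof (rule feas_residual_zero_imp_first_order[OF _ _ zero])
    show "- 1 \<le> \<mu>" "\<mu> \<le> 1"
      using kkt(2,3) unfolding less_eq_vec_def
      by (auto intro!: LIMSEQ_le_const[OF comp] LIMSEQ_le_const2[OF comp])
    show "pos_semidef Y" by (rule pos_semidef_limit[OF kkt(1) Z])
    show "trace Y \<le> 1" using kkt(4) by (intro LIMSEQ_le_const2[OF tr]) auto
  qed (intro twice_cont_diff_differentiable smooth)+
qed

end

theorem theorem13:
  fixes f :: "real ^ 'n \<Rightarrow> real"
    and h :: "real ^ 'n \<Rightarrow> real ^ 'l"
    and G :: "real ^ 'n \<Rightarrow> real ^ 'm ^ 'm"
    and \<epsilon> \<delta> \<eta> \<gamma> b1 b2 :: real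
    and x dfea d :: "nat \<Rightarrow> real ^ 'n"
    and r s :: "nat \<Rightarrow> real ^ 'l"
    and t \<rho> \<rho>' \<alpha> :: "nat \<Rightarrow> real"
    and Bfea B :: "nat \<Rightarrow> real ^ 'n ^ 'n"
    and \<mu>bar \<mu>hat :: "nat \<Rightarrow> real ^ 'l"
    and Ybar Yhat :: "nat \<Rightarrow> real ^ 'm ^ 'm"
    and \<Omega> :: "(real ^ 'n) set"
  assumes G_sym: "\<forall>z. sym_matrix (G z)"
    and params: "0 < \<epsilon>" "\<epsilon> < 1" "0 < \<delta>" "\<delta> < 1" "0 < \<eta>" "\<eta> < 1" "0 < \<gamma>" "\<gamma> < 1"
    and rho0: "0 < \<rho> 0"
    and pd: "\<forall>k. pos_def (Bfea k) \<and> pos_def (B k)"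
    and step1: "\<forall>k. feas_step h G (Bfea k) (x k) (dfea k) (r k) (s k) (t k)
                  (\<mu>bar (Suc k)) (Ybar (Suc k))"
    and step2: "\<forall>k. opt_step f h G (B k) (\<rho> k) (x k) (r k) (s k) (t k) (d k)
                  (\<mu>hat (Suc k)) (Yhat (Suc k))"
    and step3: "\<forall>k. d k \<noteq> 0"
    and step4a: "\<forall>k. \<rho>' k = penalty_multiplier_update \<epsilon> \<delta> (\<rho> k)
                   (\<mu>bar (Suc k)) (Ybar (Suc k)) (\<mu>hat (Suc k)) (Yhat (Suc k))"
    and step4b: "\<forall>k. \<rho> (Suc k) = penalty_decrease_update f h G \<epsilon> \<delta> (B k) (x k) (d k) (\<rho>' k)"
    and step5a: "\<forall>k. line_search f h G \<eta> \<gamma> (\<rho> (Suc k)) (x k) (d k) (\<alpha> k)"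
    and step5b: "\<forall>k. x (Suc k) = x k + \<alpha> k *\<^sub>R d k"
    and A1: "twice_cont_diff f" "twice_cont_diff h" "twice_cont_diff G"
    and A2: "convex \<Omega>" "compact \<Omega>" "\<forall>k. x k \<in> \<Omega>"
    and A3: "0 < b1" "b1 < b2"
      "\<forall>k z. b1 * (norm z)\<^sup>2 \<le> z \<bullet> (Bfea k *v z) \<and> z \<bullet> (Bfea k *v z) \<le> b2 * (norm z)\<^sup>2"
      "\<forall>k z. b1 * (norm z)\<^sup>2 \<le> z \<bullet> (B k *v z) \<and> z \<bullet> (B k *v z) \<le> b2 * (norm z)\<^sup>2"
  shows "(\<lambda>k. feas_residual f h G (x k) (\<mu>bar (Suc k)) (Ybar (Suc k))) \<longlonglongrightarrow> 0
       \<and> (\<forall>x' \<mu> Y. (\<exists>\<sigma> :: nat \<Rightarrow> nat. strict_mono \<sigma> \<and>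
              (\<lambda>k. (x (\<sigma> k), \<mu>bar (Suc (\<sigma> k)), Ybar (Suc (\<sigma> k)))) \<longlonglongrightarrow> (x', \<mu>, Y))
            \<longrightarrow> violation_first_order h G x' \<mu> Y)"
proof -
  interpret sqp_run f h G \<epsilon> \<delta> \<eta> \<gamma> b1 b2 x dfea d r s t \<rho> \<rho>' \<alpha> Bfea B \<mu>bar \<mu>hat Ybar Yhat \<Omega>
    by (rule sqp_run.intro; rule G_sym[rule_format] params rho0 pd[rule_format, THEN conjunct1]
        step1[rule_format] step2[rule_format] step4a[rule_format] step4b[rule_format]
        step5a[rule_format] step5b[rule_format] A1 A2(2) A2(3)[rule_format] A3(1)
        A3(3)[rule_format, THEN conjunct1] A3(3)[rule_format, THEN conjunct2]
        A3(4)[rule_format, THEN conjunct1] A3(4)[rule_format, THEN conjunct2])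
  show ?thesis
    using residual_tendsto_zero limit_point_first_order by blast
qed

end
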